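(* Let $\rho$ be an admissible kernel on $\mathbb{R}^d$ with $\int_{\mathbb{R}^d}\rho\,dz=d$ and $\operatorname{supp}\rho=\overline{B_1(0)}$, and for $\varepsilon>0$ let $\rho_\varepsilon(z):=\varepsilon^{-d}\rho(z/\varepsilon)$. Then the functionals $\operatorname{TV}_\varepsilon:L^1_{\rm loc}(\mathbb{R}^d)\to[0,\infty]$, $$\operatorname{TV}_\varepsilon(u):=\sup\Big\{\int_{\mathbb{R}^d}u\operatorname{div}_{\rho_\varepsilon}p\,dx: p\in C_c^\infty(\mathbb{R}^d;\mathbb{R}^d),\ \|p\|_{L^\infty(\mathbb{R}^d;\mathbb{R}^d)}\le1\Big\},$$ $\Gamma$-converge, with respect to the $L^1_{\rm loc}(\mathbb{R}^d)$-topology, to the functional $\operatorname{TV}$ as $\varepsilon\to0$.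
   Context: Admissible kernel: a radial function $\rho:\mathbb{R}^d\setminus\{0\}\to[0,\infty)$, $\rho(z)=\overline\rho(|z|)$, such that for some $\eta>0$, $\nu>0$, $0<\sigma\le\gamma<1$: $\inf_{\overline{B_\eta(0)}\setminus\{0\}}\rho>0$; $\rho(\cdot)\min\{1,|\cdot|^{-1}\}\in L^1(\mathbb{R}^d)$; and (H1) $f_\rho(r):=r^{d-2}\overline\rho(r)$ is nonincreasing on $(0,\infty)$ and $r\mapsto r^\nu f_\rho(r)$ is nonincreasing on $(0,\eta)$; (H2) $f_\rho$ is smooth on $(0,\infty)$ and for every $k\in\mathbb{N}$ there is $C_k>0$ with $|f_\rho^{(k)}(r)|\le C_kf_\rho(r)/r^k$ for $r\in(0,\eta)$; (H3) $r\mapsto r^{d+\sigma-1}\overline\rho(r)$ is almost nonincreasing on $(0,\eta)$; (H4) $r\mapsto r^{d+\gamma-1}\overline\rho(r)$ is almost nondecreasing on $(0,\eta)$. Here $h$ is almost nonincreasing (almost nondecreasing) if there is $C\geq 1$ with $h(s)\le Ch(r)$ (resp. $h(r)\le Ch(s)$) for all $r\le s$ in the interval. For $p\in C_c^\infty(\mathbb{R}^d;\mathbb{R}^d)$, $\operatorname{div}_{\rho_\varepsilon}p(x):=\int_{\mathbb{R}^d}\frac{p(y)-p(x)}{|y-x|}\cdot\frac{y-x}{|y-x|}\rho_\varepsilon(y-x)\,dy$. $\operatorname{TV}:L^1_{\rm loc}(\mathbb{R}^d)\to[0,\infty]$ is the classical total variation, $\operatorname{TV}(u)=\sup\{\int u\operatorname{div}p\,dx: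 p\in C_c^\infty(\mathbb{R}^d;\mathbb{R}^d),\|p\|_{L^\infty}\le1\}$. *)

theory Defs
  imports "HOL-Analysis.Analysis" "HOL-Probability.Essential_Supremum"
begin

section \<open>Smooth, compactly supported vector fields\<close>

primrec Ck :: "nat \<Rightarrow> ('a::euclidean_space \<Rightarrow> 'b::real_normed_vector) \<Rightarrow> bool" where
  "Ck 0 f \<longleftrightarrow> continuous_on UNIV f"
| "Ck (Suc k) f \<longleftrightarrow>
     (\<forall>x. f differentiable (at x)) \<and> (\<forall>v. Ck k (\<lambda>x. frechet_derivative f (at x) v))"

definition Cc_infinity :: "('a::euclidean_space \<Rightarrow> 'b::real_normed_vector) set" where
  "Cc_infinity = {p. (\<forall>k. Ck k p) \<and> compact (closure {x. p x \<noteq> 0})}"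

definition admissible_fields :: "('a::euclidean_space \<Rightarrow> 'a) set" where
  "admissible_fields =
     {p. p \<in> Cc_infinity \<and> esssup lebesgue (\<lambda>x. ereal (norm (p x))) \<le> 1}"

definition divergence :: "('a::euclidean_space \<Rightarrow> 'a) \<Rightarrow> 'a \<Rightarrow> real" where
  "divergence p x = (\<Sum>b\<in>Basis. frechet_derivative p (at x) b \<bullet> b)"


section \<open>Admissible kernels\<close>

definition almost_nonincreasing_on :: "real set \<Rightarrow> (real \<Rightarrow> real) \<Rightarrow> bool" where
  "almost_nonincreasing_on I h \<longleftrightarrow> (\<exists>C\<ge>1. \<forall>r\<in>I. \<forall>s\<in>I. r \<le> s \<longrightarrow> h s \<le> C * h r)"

definition almost_nondecreasing_on :: "real set \<Rightarrow> (real \<Rightarrow> real) \<Rightarrow> bool" where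
  "almost_nondecreasing_on I h \<longleftrightarrow> (\<exists>C\<ge>1. \<forall>r\<in>I. \<forall>s\<in>I. r \<le> s \<longrightarrow> h r \<le> C * h s)"

text \<open>
  A kernel on \<open>\<real>\<^sup>d \<setminus> {0}\<close> is represented by a total function whose value at the origin is
  unconstrained and irrelevant: all pointwise conditions exclude the origin and all integrals
  ignore it. Likewise only the values of the profile \<open>q\<close> on \<open>(0, \<infinity>)\<close> matter. The exponent
  \<open>d - 2\<close> may be negative, hence \<open>powr\<close>.
\<close>

definition admissible_kernel :: "('a::euclidean_space \<Rightarrow> real) \<Rightarrow> bool" where
  "admissible_kernel rho \<longleftrightarrow>
     (\<forall>z. z \<noteq> 0 \<longrightarrow> 0 \<le> rho z) \<and>
     integrable lebesgue (\<lambda>z. rho z * min 1 (1 / norm z)) \<and>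
     (\<exists>(q :: real \<Rightarrow> real) \<eta> \<nu> \<sigma> \<gamma>.
        (\<forall>z. z \<noteq> 0 \<longrightarrow> rho z = q (norm z)) \<and>
        0 < \<eta> \<and> 0 < \<nu> \<and> 0 < \<sigma> \<and> \<sigma> \<le> \<gamma> \<and> \<gamma> < 1 \<and>
        0 < (INF z\<in>cball 0 \<eta> - {0}. rho z) \<and>
        (let d = real DIM('a); f = (\<lambda>r. r powr (d - 2) * q r) in
           antimono_on {0<..} f \<and>
           antimono_on {0<..<\<eta>} (\<lambda>r. r powr \<nu> * f r) \<and>
           (\<forall>k. \<forall>r>0. (deriv ^^ k) f differentiable (at r)) \<and>
           (\<forall>k. \<exists>C>0. \<forall>r\<in>{0<..<\<eta>}. \<bar>(deriv ^^ k) f r\<bar> \<le> C * f r / r ^ k) \<and>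
           almost_nonincreasing_on {0<..<\<eta>} (\<lambda>r. r powr (d + \<sigma> - 1) * q r) \<and>
           almost_nondecreasing_on {0<..<\<eta>} (\<lambda>r. r powr (d + \<gamma> - 1) * q r)))"

definition rescaled_kernel :: "('a::euclidean_space \<Rightarrow> real) \<Rightarrow> real \<Rightarrow> 'a \<Rightarrow> real" where
  "rescaled_kernel rho \<epsilon> z = rho (z /\<^sub>R \<epsilon>) / \<epsilon> ^ DIM('a)"


section \<open>Local and nonlocal total variation\<close>

definition nonlocal_div :: "('a::euclidean_space \<Rightarrow> real) \<Rightarrow> ('a \<Rightarrow> 'a) \<Rightarrow> 'a \<Rightarrow> real" where
  "nonlocal_div rho p x =
     (LINT y|lebesgue.
        (((p y - p x) /\<^sub>R norm (y - x)) \<bullet> ((y - x) /\<^sub>R norm (y - x))) * rho (y - x))"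

definition TV :: "('a::euclidean_space \<Rightarrow> real) \<Rightarrow> ereal" where
  "TV u = (SUP p\<in>admissible_fields. ereal (LINT x|lebesgue. u x * divergence p x))"

definition nonlocal_TV :: "('a::euclidean_space \<Rightarrow> real) \<Rightarrow> ('a \<Rightarrow> real) \<Rightarrow> ereal" where
  "nonlocal_TV rho u =
     (SUP p\<in>admissible_fields. ereal (LINT x|lebesgue. u x * nonlocal_div rho p x))"

lemma Ck_zero: "Ck k (\<lambda>x. 0)"
  by (induction k) auto

lemma zero_in_admissible_fields: "(\<lambda>x. 0) \<in> admissible_fields"
  by (auto simp: admissible_fields_def Cc_infinity_def Ck_zero intro!: esssup_I)

lemma TV_nonneg: "0 \<le> TV u"
  unfolding TV_def
  by (rule SUP_upper2[OF zero_in_admissible_fields]) (simp add: divergence_def)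

lemma nonlocal_TV_nonneg: "0 \<le> nonlocal_TV rho u"
  unfolding nonlocal_TV_def
  by (rule SUP_upper2[OF zero_in_admissible_fields]) (simp add: nonlocal_div_def)


section \<open>The space of locally integrable functions\<close>

text \<open>
  Functions are not identified up to null sets. The topology given by the seminorms
  \<open>u \<mapsto> \<integral>\<^sub>K \<bar>u\<bar>\<close>, \<open>K\<close> compact, does not separate almost everywhere equal functions, so it is the
  pullback of the usual topology on equivalence classes.
\<close>

definition L1_loc :: "('a::euclidean_space \<Rightarrow> real) set" where
  "L1_loc = {u. \<forall>K. compact K \<longrightarrow> u absolutely_integrable_on K}"

definition L1_loc_topology :: "('a::euclidean_space \<Rightarrow> real) topology" where
  "L1_loc_topology = topology_generated_by
     {{v \<in> L1_loc. (LINT x:K|lebesgue. \<bar>v x - u x\<bar>) < r} | u K r. u \<in> L1_loc \<and> compact K \<and> 0 < r}"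

lemma topspace_L1_loc_topology [simp]: "topspace L1_loc_topology = L1_loc"
proof -
  have "u \<in> \<Union>{{v \<in> L1_loc. (LINT x:K|lebesgue. \<bar>v x - u x\<bar>) < r} | u K r.
                u \<in> L1_loc \<and> compact K \<and> 0 < r}" if "u \<in> L1_loc" for u :: "'a \<Rightarrow> real"
  proof (rule UnionI)
    show "{v \<in> L1_loc. (LINT x:{}|lebesgue. \<bar>v x - u x\<bar>) < 1} \<in>
      {{v \<in> L1_loc. (LINT x:K|lebesgue. \<bar>v x - u x\<bar>) < r} | u K r.
                u \<in> L1_loc \<and> compact K \<and> 0 < r}"
      using that compact_empty zero_less_one by blast
  qed (use that in \<open>simp add: set_lebesgue_integral_def\<close>)
  then show ?thesis
    unfolding L1_loc_topology_def topology_generated_by_topspace by blast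
qed

lemma limitin_L1_loc_topology:
  "limitin L1_loc_topology f l F \<longleftrightarrow>
     l \<in> L1_loc \<and> (\<forall>\<^sub>F n in F. f n \<in> L1_loc) \<and>
     (\<forall>K. compact K \<longrightarrow> ((\<lambda>n. LINT x:K|lebesgue. \<bar>f n x - l x\<bar>) \<longlongrightarrow> 0) F)"
  (is "?lhs \<longleftrightarrow> ?rhs")
proof
  let ?B = "\<lambda>u K r. {v \<in> L1_loc. (LINT x:K|lebesgue. \<bar>v x - u x\<bar>) < r}"
  have nonneg: "0 \<le> (LINT x:K|lebesgue. \<bar>v x - u x\<bar>)" for K :: "'a set" and u v :: "'a \<Rightarrow> real"
    by (auto simp: set_lebesgue_integral_def intro!: Bochner_Integration.integral_nonneg)
  {
    assume L: ?lhs
    then have l: "l \<in> L1_loc"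
      using limitin_topspace[OF L] by simp
    have ball: "\<forall>\<^sub>F n in F. f n \<in> ?B l K r" if "compact K" "0 < r" for K r
    proof -
      have "openin L1_loc_topology (?B l K r)"
        unfolding L1_loc_topology_def
        by (rule topology_generated_by_Basis, rule CollectI, intro exI conjI, rule refl)
           (use l that in simp_all)
      moreover have "l \<in> ?B l K r"
        using l that by (simp add: set_lebesgue_integral_def)
      ultimately show ?thesis
        by (rule limitinD[OF L])
    qed
    show ?rhs
    proof (intro conjI allI impI l)
      show "\<forall>\<^sub>F n in F. f n \<in> L1_loc"
        using ball[of "{}" 1] by (auto elim: eventually_mono)
      fix K :: "'a set" assume K: "compact K"
      show "((\<lambda>n. LINT x:K|lebesgue. \<bar>f n x - l x\<bar>) \<longlongrightarrow> 0) F"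
      proof (rule tendstoI)
        fix r :: real assume "0 < r"
        from ball[OF K this]
        show "\<forall>\<^sub>F n in F. dist (LINT x:K|lebesgue. \<bar>f n x - l x\<bar>) 0 < r"
          by (rule eventually_mono) (simp only: dist_real_def diff_zero abs_of_nonneg[OF nonneg] mem_Collect_eq)
      qed
    qed
  }
  assume R: ?rhs
  have "l \<in> U \<longrightarrow> (\<forall>\<^sub>F n in F. f n \<in> U)"
    if "generate_topology_on {?B u K r | u K r. u \<in> L1_loc \<and> compact K \<and> 0 < r} U" for U
    using that
  proof induction
    case (Int a b)
    then show ?case by (simp add: eventually_conj_iff)
  next
    case (UN \<K>)
    show ?case
    proof
      assume "l \<in> \<Union>\<K>"
      then obtain V where V: "V \<in> \<K>" "l \<in> V" by blast
      then have "\<forall>\<^sub>F n in F. f n \<in> V" using UN.IH by simp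
      then show "\<forall>\<^sub>F n in F. f n \<in> \<Union>\<K>"
        by (rule eventually_mono) (use V in blast)
    qed
  next
    case (Basis s)
    then obtain u K r where s: "s = ?B u K r" and u: "u \<in> L1_loc" and K: "compact K"
      by blast
    show ?case
    proof
      assume "l \<in> s"
      then have lt: "(LINT x:K|lebesgue. \<bar>l x - u x\<bar>) < r" and l: "l \<in> L1_loc"
        using s by auto
      have lim: "\<forall>\<^sub>F n in F. (LINT x:K|lebesgue. \<bar>f n x - l x\<bar>) < r - (LINT x:K|lebesgue. \<bar>l x - u x\<bar>)"
        using R K lt by (intro order_tendstoD(2)[where y = 0]) simp_all
      have "\<forall>\<^sub>F n in F. f n \<in> L1_loc" using R by blast
      then show "\<forall>\<^sub>F n in F. f n \<in> s"
        using lim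
      proof eventually_elim
        case (elim n)
        have int: "set_integrable lebesgue K (\<lambda>x. \<bar>v x - w x\<bar>)"
          if "v \<in> L1_loc" "w \<in> L1_loc" for v w :: "'a \<Rightarrow> real"
          using that K set_integral_diff(1)[of lebesgue K v w, THEN set_integrable_abs]
          by (auto simp: L1_loc_def)
        have "(LINT x:K|lebesgue. \<bar>f n x - u x\<bar>)
              \<le> (LINT x:K|lebesgue. \<bar>f n x - l x\<bar> + \<bar>l x - u x\<bar>)"
          using elim l u by (intro set_integral_mono int set_integral_add(1)) auto
        also have "\<dots> = (LINT x:K|lebesgue. \<bar>f n x - l x\<bar>) + (LINT x:K|lebesgue. \<bar>l x - u x\<bar>)"
          using elim l u by (intro set_integral_add(2) int)
        finally show ?case
          using elim s by auto
      qed
    qed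
  qed auto
  then show ?lhs
    using R unfolding limitin_def topspace_L1_loc_topology
    by (simp add: L1_loc_topology_def openin_topology_generated_by_iff)
qed


section \<open>Gamma-convergence\<close>

definition Gamma_lim_seq ::
    "'x topology \<Rightarrow> (nat \<Rightarrow> 'x \<Rightarrow> ereal) \<Rightarrow> ('x \<Rightarrow> ereal) \<Rightarrow> bool" where
  "Gamma_lim_seq X F G \<longleftrightarrow>
     (\<forall>u\<in>topspace X. \<forall>v. range v \<subseteq> topspace X \<and> limitin X v u sequentially \<longrightarrow>
        G u \<le> liminf (\<lambda>n. F n (v n))) \<and>
     (\<forall>u\<in>topspace X. \<exists>v. range v \<subseteq> topspace X \<and> limitin X v u sequentially \<and>
        limsup (\<lambda>n. F n (v n)) \<le> G u)"

text \<open>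
  For a family indexed by a continuous parameter, Gamma-convergence along a filter means
  Gamma-convergence along every sequence of parameters tending to that filter.
\<close>

definition Gamma_lim ::
    "'x topology \<Rightarrow> ('i \<Rightarrow> 'x \<Rightarrow> ereal) \<Rightarrow> ('x \<Rightarrow> ereal) \<Rightarrow> 'i filter \<Rightarrow> bool" where
  "Gamma_lim X F G \<Phi> \<longleftrightarrow>
     (\<forall>e. filterlim e \<Phi> sequentially \<longrightarrow> Gamma_lim_seq X (\<lambda>n. F (e n)) G)"

end

theory Submission
  imports Defs
begin

text \<open>
  The nonlocal divergence of a radial kernel is an average of the classical divergence. If \<open>q\<close> is
  the profile of the kernel \<open>rho\<close>, then the integral \<open>Q(w)\<close> of \<open>q(r) / r\<close> over \<open>r > |w|\<close> satisfies
  \<open>grad Q(w) = - rho(w) w / |w|\<^sup>2\<close>. Integration by parts, together with the oddness of this gradient,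
  gives
  \<open>nonlocal_div rho p x = \<integral> (p (x + w) - p x) \<bullet> w / |w|\<^sup>2 rho(w) dw = \<integral> Q(w) div p (x + w) dw\<close>,
  and testing with the identity field shows \<open>\<integral> Q = \<integral> rho / d = 1\<close>. So \<open>Q\<close> is a probability
  density, and for the rescaled kernel it lives on the ball of radius \<open>\<epsilon>\<close>. This is
  \<open>nonlocal_div_eq_average_divergence\<close>; the singularity at the origin is handled by truncating
  the profile and passing to the limit.

  Both halves of Gamma-convergence follow. The average of an admissible field is admissible and its
  divergence is the averaged divergence, so every nonlocal test value of \<open>u\<close> is a local one and
  the nonlocal total variation is at most \<open>TV u\<close> (\<open>nonlocal_TV_le_TV\<close>); constant sequences are
  therefore recovery sequences. For the lower bound, fix a test field \<open>p\<close>. Averaging the Lipschitz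
  function \<open>div p\<close> over a ball of radius \<open>\<epsilon>\<close> moves it by at most \<open>L \<epsilon>\<close>, so the nonlocal divergences
  converge uniformly with supports in a common compact set, and their pairings with a sequence
  converging in \<open>L\<^sup>1\<^sub>l\<^sub>o\<^sub>c\<close> converge (\<open>pairing_nonlocal_div_tendsto\<close>). Taking the supremum over
  \<open>p\<close> yields lower semicontinuity.
\<close>

section \<open>Smooth fields with compact support\<close>

lemma derivative_outside_support:
  fixes f :: "'a::euclidean_space \<Rightarrow> 'b::real_normed_vector"
  assumes der: "(f has_derivative f') (at x)"
    and supp: "\<And>x. M < norm x \<Longrightarrow> f x = 0" and x: "M < norm x"
  shows "f' v = 0"
proof -
  have "open {x::'a. M < norm x}"
    by (intro open_Collect_less continuous_intros)
  then have "((\<lambda>x. 0) has_derivative f') (at x)"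
    using x by (intro has_derivative_transform_within_open[OF der]) (auto simp: supp)
  then have "f' = (\<lambda>v. 0)"
    by (rule has_derivative_unique) (rule has_derivative_const)
  then show ?thesis by simp
qed

lemma bounded_if_continuous_compact_support:
  fixes f :: "'a::euclidean_space \<Rightarrow> 'b::real_normed_vector"
  assumes cont: "continuous_on UNIV f" and supp: "\<And>x. M < norm x \<Longrightarrow> f x = 0"
  obtains B where "0 \<le> B" "\<And>x. norm (f x) \<le> B"
proof -
  have "compact (f ` cball 0 M)"
    by (intro compact_continuous_image continuous_on_subset[OF cont]) auto
  then obtain B where B: "\<And>y. y \<in> f ` cball 0 M \<Longrightarrow> norm y \<le> B"
    using compact_imp_bounded bounded_iff by metis
  show ?thesis
  proof (rule that[of "max B 0"])
    fix x show "norm (f x) \<le> max B 0"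
      using B[of "f x"] supp[of x] by (cases "norm x \<le> M") force+
  qed simp
qed

text \<open>
  The partial derivatives are continuous with compact support, hence bounded, and the operator
  norm of the derivative is at most the sum of their norms.
\<close>

lemma lipschitz_if_C1_compact_support:
  fixes f :: "'a::euclidean_space \<Rightarrow> 'b::real_normed_vector"
  assumes der: "\<And>x. (f has_derivative f' x) (at x)"
    and cont: "\<And>b. b \<in> Basis \<Longrightarrow> continuous_on UNIV (\<lambda>x. f' x b)"
    and supp: "\<And>x. M < norm x \<Longrightarrow> f x = 0"
  obtains L where "0 \<le> L" "\<And>x y. norm (f x - f y) \<le> L * norm (x - y)"
proof -
  have "\<exists>B. 0 \<le> B \<and> (\<forall>x. norm (f' x b) \<le> B)" if "b \<in> Basis" for b
    using bounded_if_continuous_compact_support[OF cont[OF that]]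
      derivative_outside_support[OF der supp] by metis
  then obtain B where B: "\<And>b. b \<in> Basis \<Longrightarrow> 0 \<le> B b" "\<And>b x. b \<in> Basis \<Longrightarrow> norm (f' x b) \<le> B b"
    by metis
  show ?thesis
  proof (rule that[of "sum B Basis"])
    fix x y
    show "norm (f x - f y) \<le> sum B Basis * norm (x - y)"
    proof (rule differentiable_bound[of UNIV f f'])
      fix x show "onorm (f' x) \<le> sum B Basis"
        by (intro onorm_componentwise_le sum_mono B has_derivative_bounded_linear[OF der])
    qed (use der in auto)
  qed (auto intro: sum_nonneg B)
qed

lemma Cc_infinityE:
  fixes p :: "'a::euclidean_space \<Rightarrow> 'b::real_normed_vector"
  assumes "p \<in> Cc_infinity"
  obtains M where "0 < M" "\<And>x. M < norm x \<Longrightarrow> p x = 0"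
proof -
  have "bounded {x. p x \<noteq> 0}"
    using assms compact_imp_bounded bounded_subset[OF _ closure_subset]
    unfolding Cc_infinity_def by blast
  then obtain M where "0 < M" "\<forall>x\<in>{x. p x \<noteq> 0}. norm x \<le> M"
    unfolding bounded_pos by auto
  then show ?thesis
    by (intro that[of M]) force+
qed

lemma Cc_infinityI:
  fixes p :: "'a::euclidean_space \<Rightarrow> 'b::real_normed_vector"
  assumes "\<And>k. Ck k p" "\<And>x. M < norm x \<Longrightarrow> p x = 0"
  shows "p \<in> Cc_infinity"
proof -
  have "bounded {x. p x \<noteq> 0}"
    unfolding bounded_iff using assms(2) by (intro exI[of _ M]) force
  then show ?thesis
    using assms(1) by (simp add: Cc_infinity_def compact_closure)
qed

lemma Cc_infinity_has_derivative:
  assumes "p \<in> Cc_infinity"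
  shows "(p has_derivative frechet_derivative p (at x)) (at x)"
proof -
  have "Ck (Suc 0) p" using assms unfolding Cc_infinity_def by blast
  then show ?thesis by (simp add: frechet_derivative_works)
qed

lemma Cc_infinity_continuous: "p \<in> Cc_infinity \<Longrightarrow> continuous_on UNIV p"
  by (metis (mono_tags) Ck.simps(1) Cc_infinity_def mem_Collect_eq)

lemma Cc_infinity_derivative:
  assumes "p \<in> Cc_infinity"
  shows "(\<lambda>x. frechet_derivative p (at x) v) \<in> Cc_infinity"
proof -
  obtain M where M: "\<And>x. M < norm x \<Longrightarrow> p x = 0"
    using assms by (metis Cc_infinityE)
  show ?thesis
  proof (rule Cc_infinityI[of _ M])
    fix k
    have "Ck (Suc k) p" using assms unfolding Cc_infinity_def by blast
    then show "Ck k (\<lambda>x. frechet_derivative p (at x) v)" by simp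
  qed (rule derivative_outside_support[OF Cc_infinity_has_derivative[OF assms] M])
qed

lemma Cc_infinity_lipschitz:
  assumes "p \<in> Cc_infinity"
  obtains L where "0 \<le> L" "\<And>x y. norm (p x - p y) \<le> L * norm (x - y)"
proof -
  obtain M where M: "\<And>x. M < norm x \<Longrightarrow> p x = 0"
    using assms by (metis Cc_infinityE)
  show ?thesis
    by (rule lipschitz_if_C1_compact_support[OF Cc_infinity_has_derivative[OF assms] _ M that])
       (use Cc_infinity_derivative[OF assms] in \<open>auto intro: Cc_infinity_continuous\<close>)
qed

lemma Cc_infinity_bounded:
  assumes "p \<in> Cc_infinity"
  obtains B where "0 \<le> B" "\<And>x. norm (p x) \<le> B"
proof -
  obtain M where M: "\<And>x. M < norm x \<Longrightarrow> p x = 0"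
    using assms by (metis Cc_infinityE)
  show ?thesis
    by (rule bounded_if_continuous_compact_support[OF Cc_infinity_continuous[OF assms] M that]) auto
qed

text \<open>
  The second-order Taylor estimate. All first derivatives are again in \<^const>\<open>Cc_infinity\<close> and
  therefore Lipschitz, which makes the linearization error quadratic, uniformly in the base point.
\<close>

lemma Cc_infinity_linearization:
  fixes p :: "'a::euclidean_space \<Rightarrow> 'b::real_normed_vector"
  assumes p: "p \<in> Cc_infinity"
  obtains L where "0 \<le> L"
    "\<And>x h. norm (p (x + h) - p x - frechet_derivative p (at x) h) \<le> L * norm h ^ 2"
proof -
  let ?p' = "\<lambda>x. frechet_derivative p (at x)"
  note der = Cc_infinity_has_derivative[OF p]
  have "\<exists>L. 0 \<le> L \<and> (\<forall>x y. norm (?p' x b - ?p' y b) \<le> L * norm (x - y))" for b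
    using Cc_infinity_lipschitz[OF Cc_infinity_derivative[OF p, of b]] by metis
  then obtain L where L: "\<And>b. 0 \<le> L b" "\<And>b x y. norm (?p' x b - ?p' y b) \<le> L b * norm (x - y)"
    by metis
  show ?thesis
  proof (rule that[of "sum L Basis"])
    fix x h :: 'a
    have "norm (p (x + h) - p x - ?p' x (x + h - x)) \<le> norm (x + h - x) * (sum L Basis * norm h)"
    proof (rule differentiable_bound_linearization[of _ _ "cball x (norm h)"])
      fix y assume y: "y \<in> cball x (norm h)"
      have "onorm (?p' y - ?p' x) \<le> (\<Sum>b\<in>Basis. norm ((?p' y - ?p' x) b))"
        unfolding fun_diff_def
        by (intro onorm_componentwise bounded_linear_sub has_derivative_bounded_linear[OF der])
      also have "\<dots> \<le> (\<Sum>b\<in>Basis. L b * norm (y - x))"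
        by (intro sum_mono) (use L in auto)
      also have "\<dots> \<le> (\<Sum>b\<in>Basis. L b * norm h)"
        using y L(1) by (intro sum_mono mult_left_mono) (auto simp: dist_norm norm_minus_commute)
      finally show "onorm (?p' y - ?p' x) \<le> sum L Basis * norm h"
        by (simp add: sum_distrib_right)
    next
      show "(p has_derivative ?p' y) (at y within cball x (norm h))" for y
        using der by (rule has_derivative_at_withinI)
    qed (auto simp: dist_norm mult_left_le_one_le)
    then show "norm (p (x + h) - p x - ?p' x h) \<le> sum L Basis * norm h ^ 2"
      by (simp add: power2_eq_square algebra_simps)
  qed (auto intro: sum_nonneg L)
qed

lemma divergence_regular:
  fixes p :: "'a::euclidean_space \<Rightarrow> 'a"
  assumes p: "p \<in> Cc_infinity"
  obtains L B where "0 \<le> L" "0 \<le> B"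
    "\<And>x y. \<bar>divergence p x - divergence p y\<bar> \<le> L * norm (x - y)"
    "\<And>x. \<bar>divergence p x\<bar> \<le> B"
    "continuous_on UNIV (divergence p)"
proof -
  let ?p' = "\<lambda>x. frechet_derivative p (at x)"
  have "\<exists>L. 0 \<le> L \<and> (\<forall>x y. norm (?p' x b - ?p' y b) \<le> L * norm (x - y))" for b
    using Cc_infinity_lipschitz[OF Cc_infinity_derivative[OF p, of b]] by metis
  then obtain L where L: "\<And>b. 0 \<le> L b" "\<And>b x y. norm (?p' x b - ?p' y b) \<le> L b * norm (x - y)"
    by metis
  have "\<exists>B. 0 \<le> B \<and> (\<forall>x. norm (?p' x b) \<le> B)" for b
    using Cc_infinity_bounded[OF Cc_infinity_derivative[OF p, of b]] by metis
  then obtain B where B: "\<And>b. 0 \<le> B b" "\<And>b x. norm (?p' x b) \<le> B b"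
    by metis
  show ?thesis
  proof (rule that[of "sum L Basis" "sum B Basis"])
    fix x y
    have "\<bar>divergence p x - divergence p y\<bar> = \<bar>\<Sum>b\<in>Basis. (?p' x b - ?p' y b) \<bullet> b\<bar>"
      by (simp add: divergence_def sum_subtractf inner_diff_left)
    also have "\<dots> \<le> (\<Sum>b\<in>Basis. norm (?p' x b - ?p' y b))"
      by (rule order_trans[OF sum_abs])
         (intro sum_mono, metis Basis_le_norm)
    also have "\<dots> \<le> (\<Sum>b\<in>Basis. L b * norm (x - y))"
      by (intro sum_mono L)
    finally show "\<bar>divergence p x - divergence p y\<bar> \<le> sum L Basis * norm (x - y)"
      by (simp add: sum_distrib_right)
    have "\<bar>divergence p x\<bar> \<le> (\<Sum>b\<in>Basis. norm (?p' x b))"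
      unfolding divergence_def
      by (rule order_trans[OF sum_abs])
         (intro sum_mono, metis Basis_le_norm)
    also have "\<dots> \<le> sum B Basis"
      by (intro sum_mono B)
    finally show "\<bar>divergence p x\<bar> \<le> sum B Basis" .
  next
    show "continuous_on UNIV (divergence p)"
      unfolding divergence_def[abs_def]
      by (intro continuous_intros Cc_infinity_continuous Cc_infinity_derivative p)
  qed (auto intro: sum_nonneg L B)
qed

lemma divergence_outside_support:
  assumes p: "p \<in> Cc_infinity" and supp: "\<And>x. M < norm x \<Longrightarrow> p x = 0" and "M < norm x"
  shows "divergence p x = 0"
  by (simp add: divergence_def derivative_outside_support[OF Cc_infinity_has_derivative[OF p] assms(2,3)])

section \<open>Integration by parts on Euclidean space\<close>

lemma lborel_integral_affine:
  fixes f :: "'a::euclidean_space \<Rightarrow> 'b::{banach, second_countable_topology}"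
  assumes [measurable]: "f \<in> borel_measurable borel" and c: "c \<noteq> 0"
  shows "(\<integral>x. f x \<partial>lborel) = (\<integral>x. \<bar>c\<bar> ^ DIM('a) *\<^sub>R f (t + c *\<^sub>R x) \<partial>lborel)"
  by (subst lborel_affine[OF c, of t])
     (subst integral_density; simp add: integral_distr)

lemma lborel_integral_translate:
  fixes f :: "'a::euclidean_space \<Rightarrow> 'b::{banach, second_countable_topology}"
  assumes "f \<in> borel_measurable borel"
  shows "(\<integral>x. f (a + x) \<partial>lborel) = (\<integral>x. f x \<partial>lborel)"
  using lborel_integral_affine[OF assms, of 1 a] by simp

lemma lborel_integral_odd:
  fixes f :: "'a::euclidean_space \<Rightarrow> 'b::{banach, second_countable_topology}"
  assumes "f \<in> borel_measurable borel" and odd: "\<And>x. f (- x) = - f x"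
  shows "(\<integral>x. f x \<partial>lborel) = 0"
proof -
  have "(\<integral>x. f x \<partial>lborel) = - (\<integral>x. f x \<partial>lborel)"
    using lborel_integral_affine[OF assms(1), of "-1" 0] by (simp add: odd)
  then have "2 *\<^sub>R (\<integral>x. f x \<partial>lborel) = 0"
    by (metis add.right_inverse scaleR_2)
  then show ?thesis by simp
qed

lemma integrable_continuous_compact_support:
  fixes f :: "'a::euclidean_space \<Rightarrow> 'b::{banach, second_countable_topology}"
  assumes "continuous_on UNIV f" and supp: "\<And>x. M < norm x \<Longrightarrow> f x = 0"
  shows "integrable lborel f"
proof -
  have "integrable lborel (\<lambda>x. indicator (cball 0 M) x *\<^sub>R f x)"
    by (intro borel_integrable_compact continuous_on_subset[OF assms(1)]) auto
  also have "(\<lambda>x. indicator (cball 0 M) x *\<^sub>R f x) = f"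
    using supp by (auto simp: indicator_def not_le)
  finally show ?thesis .
qed

text \<open>
  Translation invariance makes every difference quotient of \<open>g\<close> integrate to zero. By the
  Lipschitz bound the quotients are dominated on one fixed ball, so the integral of their limit
  is zero too.
\<close>

lemma integral_derivative_compact_support:
  fixes g :: "'a::euclidean_space \<Rightarrow> real"
  assumes der: "\<And>x. (g has_derivative g' x) (at x)"
    and cont: "\<And>v. continuous_on UNIV (\<lambda>x. g' x v)"
    and supp: "\<And>x. M < norm x \<Longrightarrow> g x = 0"
  shows "(\<integral>x. g' x v \<partial>lborel) = 0"
proof -
  have cont_g: "continuous_on UNIV g"
    using has_derivative_continuous_on[of UNIV g g'] der by simp
  have [measurable]: "g \<in> borel_measurable borel"
    by (rule borel_measurable_continuous_onI[OF cont_g])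
  obtain L where L: "0 \<le> L" "\<And>x y. norm (g x - g y) \<le> L * norm (x - y)"
    by (rule lipschitz_if_C1_compact_support[OF der cont supp]) auto
  \<comment> \<open>Step sizes of the difference quotients; \<open>t n \<le> 1\<close> keeps the translated supports in one ball.\<close>
  define t where "t n = inverse (real (Suc n))" for n
  have t: "filterlim t (at 0) sequentially" "\<And>n. 0 < t n" "\<And>n. t n \<le> 1"
    using LIMSEQ_inverse_real_of_nat
    by (auto simp: t_def[abs_def] filterlim_at inverse_le_1_iff simp del: inverse_eq_divide)
  define s where "s n x = (g (x + t n *\<^sub>R v) - g x) / t n" for n x
  have int_g: "integrable lborel g"
    by (rule integrable_continuous_compact_support[OF cont_g supp])
  have int_gt: "integrable lborel (\<lambda>x. g (x + a))" for a
    by (rule integrable_continuous_compact_support[of _ "M + norm a"])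
       (auto intro!: supp continuous_on_compose2[OF cont_g] continuous_intros
             intro: order.strict_trans2[OF _ norm_diff_ineq])
  have s0: "(\<integral>x. s n x \<partial>lborel) = 0" for n
    using lborel_integral_translate[of g "t n *\<^sub>R v"]
    by (simp add: s_def int_g int_gt add.commute)
  have "(\<lambda>n. \<integral>x. s n x \<partial>lborel) \<longlonglongrightarrow> (\<integral>x. g' x v \<partial>lborel)"
  proof (rule integral_dominated_convergence[where
        w = "\<lambda>x. indicator (cball 0 (M + norm v)) x *\<^sub>R (L * norm v)"])
    show "(\<lambda>x. g' x v) \<in> borel_measurable lborel"
      using borel_measurable_continuous_onI[OF cont] by simp
    show "s n \<in> borel_measurable lborel" for n
      unfolding s_def by measurable
    show "integrable lborel (\<lambda>x::'a. indicator (cball 0 (M + norm v)) x *\<^sub>R (L * norm v))"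
      by (intro borel_integrable_compact) auto
    show "AE x in lborel. (\<lambda>n. s n x) \<longlonglongrightarrow> g' x v"
    proof (intro AE_I2)
      fix x
      have "((\<lambda>\<tau>. g (x + \<tau> *\<^sub>R v)) has_derivative (\<lambda>\<tau>. g' (x + 0 *\<^sub>R v) (\<tau> *\<^sub>R v))) (at 0)"
        by (rule has_derivative_compose[OF _ der]) (auto intro!: derivative_eq_intros)
      then have "((\<lambda>\<tau>. g (x + \<tau> *\<^sub>R v)) has_real_derivative g' x v) (at 0)"
        by (simp add: has_field_derivative_def mult_commute_abs
            linear_scale[OF has_derivative_linear[OF der]])
      then have "((\<lambda>h. (g (x + h *\<^sub>R v) - g x) / h) \<longlongrightarrow> g' x v) (at 0)"
        by (simp add: DERIV_def)
      then show "(\<lambda>n. s n x) \<longlonglongrightarrow> g' x v"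
        unfolding s_def using t(1) by (rule filterlim_compose)
    qed
    show "AE x in lborel. norm (s n x) \<le> indicator (cball 0 (M + norm v)) x *\<^sub>R (L * norm v)" for n
    proof (intro AE_I2)
      fix x
      have "norm (s n x) \<le> L * norm v"
        using L(2)[of "x + t n *\<^sub>R v" x] t(2)[of n]
        by (simp add: s_def divide_simps algebra_simps)
      moreover have "s n x = 0" if "M + norm v < norm x"
      proof -
        have "norm (t n *\<^sub>R v) \<le> norm v"
          using t(2,3)[of n] by (simp add: mult_left_le_one_le less_imp_le)
        then have "M < norm (x + t n *\<^sub>R v)" "M < norm x"
          using that norm_diff_ineq[of x "t n *\<^sub>R v"] norm_ge_zero[of v] by linarith+
        then show ?thesis by (simp add: s_def supp)
      qed
      ultimately show "norm (s n x) \<le> indicator (cball 0 (M + norm v)) x *\<^sub>R (L * norm v)"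
        by (auto simp: indicator_def)
    qed
  qed
  then show ?thesis
    by (simp add: s0 LIMSEQ_const_iff)
qed

lemma integration_by_parts_compact_support:
  fixes f g :: "'a::euclidean_space \<Rightarrow> real"
  assumes f: "\<And>x. (f has_derivative f' x) (at x)" "\<And>v. continuous_on UNIV (\<lambda>x. f' x v)"
    and g: "\<And>x. (g has_derivative g' x) (at x)" "\<And>v. continuous_on UNIV (\<lambda>x. g' x v)"
    and supp: "\<And>x. M < norm x \<Longrightarrow> g x = 0"
  shows "integrable lborel (\<lambda>x. f' x v * g x)"
    and "integrable lborel (\<lambda>x. f x * g' x v)"
    and "(\<integral>x. f' x v * g x \<partial>lborel) = - (\<integral>x. f x * g' x v \<partial>lborel)"
proof -
  have cont: "continuous_on UNIV f" "continuous_on UNIV g"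
    using has_derivative_continuous_on[of UNIV f f'] has_derivative_continuous_on[of UNIV g g'] f g
    by simp_all
  show int: "integrable lborel (\<lambda>x. f' x v * g x)" "integrable lborel (\<lambda>x. f x * g' x v)"
    by (rule integrable_continuous_compact_support[of _ M],
        use f g cont derivative_outside_support[OF g(1) supp]
        in \<open>auto intro!: continuous_on_mult simp: supp\<close>)+
  have "(\<integral>x. f x * g' x v + f' x v * g x \<partial>lborel) = 0"
    by (rule integral_derivative_compact_support[of "\<lambda>x. f x * g x" _ M])
       (use f g cont in \<open>auto intro!: has_derivative_mult continuous_on_add continuous_on_mult simp: supp\<close>)
  then show "(\<integral>x. f' x v * g x \<partial>lborel) = - (\<integral>x. f x * g' x v \<partial>lborel)"
    using int by simp
qed

section \<open>Averages of smooth fields\<close>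

definition averaging_kernel :: "real \<Rightarrow> ('a::euclidean_space \<Rightarrow> real) \<Rightarrow> bool" where
  "averaging_kernel R Q \<longleftrightarrow>
     integrable lborel Q \<and> (\<integral>w. Q w \<partial>lborel) = 1 \<and> (\<forall>w. 0 \<le> Q w) \<and> (\<forall>w. R < norm w \<longrightarrow> Q w = 0)"

text \<open>
  For symmetric \<open>Q\<close> this is the convolution of \<open>f\<close> with \<open>Q\<close>.
\<close>

definition average :: "('a::euclidean_space \<Rightarrow> real) \<Rightarrow> ('a \<Rightarrow> 'b::euclidean_space) \<Rightarrow> 'a \<Rightarrow> 'b" where
  "average Q f x = (\<integral>w. Q w *\<^sub>R f (x + w) \<partial>lborel)"

lemma average_integrable:
  fixes f :: "'a::euclidean_space \<Rightarrow> 'b::euclidean_space"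
  assumes Q: "averaging_kernel R Q"
    and f: "f \<in> borel_measurable borel" "\<And>x. norm (f x) \<le> B"
  shows "integrable lborel (\<lambda>w. Q w *\<^sub>R f (x + w))"
proof (rule Bochner_Integration.integrable_bound)
  note [measurable] = f(1)
  have [measurable]: "Q \<in> borel_measurable borel"
    using Q by (auto simp: averaging_kernel_def dest: borel_measurable_integrable)
  show "integrable lborel (\<lambda>w. Q w * B)"
    using Q by (simp add: averaging_kernel_def)
  show "(\<lambda>w. Q w *\<^sub>R f (x + w)) \<in> borel_measurable lborel"
    by measurable
  have "norm (Q w *\<^sub>R f (x + w)) \<le> norm (Q w * B)" for w
    using f(2)[of "x + w"] by (simp add: abs_mult mult_left_mono)
  then show "AE w in lborel. norm (Q w *\<^sub>R f (x + w)) \<le> norm (Q w * B)"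
    by simp
qed

lemma norm_average_le:
  fixes f :: "'a::euclidean_space \<Rightarrow> 'b::euclidean_space"
  assumes Q: "averaging_kernel R Q"
    and f: "f \<in> borel_measurable borel" "\<And>w. norm w \<le> R \<Longrightarrow> norm (f (x + w)) \<le> C"
  shows "norm (average Q f x) \<le> C"
proof -
  have bound: "norm (Q w *\<^sub>R f (x + w)) \<le> Q w * C" for w
    using Q f(2)[of w] by (cases "norm w \<le> R") (auto simp: averaging_kernel_def mult_left_mono)
  have "norm (average Q f x) \<le> (\<integral>w. norm (Q w *\<^sub>R f (x + w)) \<partial>lborel)"
    unfolding average_def by (rule integral_norm_bound)
  also have "\<dots> \<le> (\<integral>w. Q w * C \<partial>lborel)"
    using Q bound by (intro integral_mono') (auto simp: averaging_kernel_def intro: order_trans[OF norm_ge_zero bound])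
  also have "\<dots> = C"
    using Q by (simp add: averaging_kernel_def)
  finally show ?thesis .
qed

lemma average_diff:
  fixes f :: "'a::euclidean_space \<Rightarrow> 'b::euclidean_space"
  assumes Q: "averaging_kernel R Q"
    and f: "f \<in> borel_measurable borel" "\<And>x. norm (f x) \<le> B"
    and g: "g \<in> borel_measurable borel" "\<And>x. norm (g x) \<le> C"
  shows "average Q (\<lambda>x. f x - g x) x = average Q f x - average Q g x"
  by (simp add: average_def scaleR_diff_right average_integrable[OF Q f] average_integrable[OF Q g])

lemma average_lipschitz_close:
  fixes f :: "'a::euclidean_space \<Rightarrow> 'b::euclidean_space"
  assumes Q: "averaging_kernel R Q"
    and f: "f \<in> borel_measurable borel" "\<And>x. norm (f x) \<le> B"
    and L: "0 \<le> L" "\<And>x y. norm (f x - f y) \<le> L * norm (x - y)"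
  shows "norm (average Q f x - f x) \<le> L * R"
proof -
  have "average Q (\<lambda>_. f x) x = f x"
    using Q by (simp add: average_def averaging_kernel_def)
  then have "average Q f x - f x = average Q (\<lambda>y. f y - f x) x"
    using average_diff[OF Q f, of "\<lambda>_. f x" B] f(2) by simp
  moreover have "norm (average Q (\<lambda>y. f y - f x) x) \<le> L * R"
  proof (rule norm_average_le[OF Q])
    show "(\<lambda>y. f y - f x) \<in> borel_measurable borel"
      using f(1) by measurable
    fix w :: 'a assume "norm w \<le> R"
    then show "norm (f (x + w) - f x) \<le> L * R"
      using L(2)[of "x + w" x] L(1) by (auto intro: order_trans mult_left_mono)
  qed
  ultimately show ?thesis by simp
qed

text \<open>
  Differentiation under the integral sign. The quadratic Taylor estimate holds uniformly in the
  base point and survives averaging against a probability density, so \<open>Q\<close> may be singular at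
  the origin.
\<close>

lemma average_has_derivative:
  fixes f :: "'a::euclidean_space \<Rightarrow> 'b::euclidean_space"
  assumes Q: "averaging_kernel R Q" and f: "f \<in> Cc_infinity"
  shows "(average Q f has_derivative (\<lambda>h. average Q (\<lambda>y. frechet_derivative f (at y) h) x)) (at x)"
proof -
  let ?f' = "\<lambda>y. frechet_derivative f (at y)"
  have meas: "g \<in> borel_measurable borel" if "g \<in> Cc_infinity" for g :: "'a \<Rightarrow> 'b"
    using that by (intro borel_measurable_continuous_onI Cc_infinity_continuous)
  have int: "integrable lborel (\<lambda>w. Q w *\<^sub>R g (x + w))" if "g \<in> Cc_infinity" for g :: "'a \<Rightarrow> 'b" and x
    using Cc_infinity_bounded[OF that] average_integrable[OF Q meas[OF that]] by metis
  note int_f' = int[OF Cc_infinity_derivative[OF f]]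
  obtain L where L: "0 \<le> L"
      "\<And>x h. norm (f (x + h) - f x - ?f' x h) \<le> L * norm h ^ 2"
    using f by (metis Cc_infinity_linearization)
  have lin: "linear (?f' y)" for y
    by (rule has_derivative_linear[OF Cc_infinity_has_derivative[OF f]])
  have "linear (\<lambda>h. average Q (\<lambda>y. ?f' y h) x)"
  proof (rule linearI)
    show "average Q (\<lambda>y. ?f' y (h + k)) x
        = average Q (\<lambda>y. ?f' y h) x + average Q (\<lambda>y. ?f' y k) x" for h k
      by (simp add: average_def linear_add[OF lin] scaleR_add_right int_f')
    show "average Q (\<lambda>y. ?f' y (c *\<^sub>R h)) x = c *\<^sub>R average Q (\<lambda>y. ?f' y h) x" for c h
      by (simp add: average_def linear_scale[OF lin] mult.commute int_f' flip: integral_scaleR_right)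
  qed
  moreover have "((\<lambda>h. norm (average Q f (x + h) - average Q f x
        - average Q (\<lambda>y. ?f' y h) x) / norm h) \<longlongrightarrow> 0) (at 0)"
  proof (rule Lim_null_comparison)
    have bound: "norm (average Q f (x + h) - average Q f x - average Q (\<lambda>y. ?f' y h) x)
        \<le> L * norm h ^ 2" for h
    proof -
      note [measurable] = meas[OF f] meas[OF Cc_infinity_derivative[OF f]]
      have "average Q f (x + h) - average Q f x - average Q (\<lambda>y. ?f' y h) x
          = average Q (\<lambda>y. f (y + h) - f y - ?f' y h) x"
        using int[OF f, of x] int[OF f, of "x + h"] int_f'[of x]
        by (simp add: average_def scaleR_diff_right add.assoc add.commute add.left_commute)
      also have "norm \<dots> \<le> L * norm h ^ 2"
        by (rule norm_average_le[OF Q]) (use L in auto)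
      finally show ?thesis .
    qed
    show "\<forall>\<^sub>F h in at 0. norm (norm (average Q f (x + h) - average Q f x
        - average Q (\<lambda>y. ?f' y h) x) / norm h) \<le> L * norm h"
      using bound by (intro always_eventually allI)
        (auto simp: divide_le_eq power2_eq_square mult.assoc)
    show "((\<lambda>h. L * norm h) \<longlongrightarrow> 0) (at 0)"
      by (auto intro!: tendsto_eq_intros)
  qed
  ultimately show ?thesis
    by (simp add: has_derivative_at linear_conv_bounded_linear)
qed

lemma average_Cc_infinity:
  fixes f :: "'a::euclidean_space \<Rightarrow> 'b::euclidean_space"
  assumes Q: "averaging_kernel R Q" and f: "f \<in> Cc_infinity"
  shows "average Q f \<in> Cc_infinity"
proof -
  have *: "frechet_derivative (average Q g) (at x) v = average Q (\<lambda>y. frechet_derivative g (at y) v) x"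
    if "g \<in> Cc_infinity" for g :: "'a \<Rightarrow> 'b" and x v
    by (simp add: frechet_derivative_at[OF average_has_derivative[OF Q that], symmetric])
  have Ck: "Ck k (average Q g)" if "g \<in> Cc_infinity" for k and g :: "'a \<Rightarrow> 'b"
    using that
  proof (induction k arbitrary: g)
    case 0
    show ?case
      using average_has_derivative[OF Q 0]
      by (auto simp: continuous_on_eq_continuous_within intro: has_derivative_continuous)
  next
    case (Suc k)
    then show ?case
      using average_has_derivative[OF Q Suc.prems]
      by (auto simp: * Cc_infinity_derivative differentiable_def)
  qed
  obtain M where "0 < M" and M: "\<And>x. M < norm x \<Longrightarrow> f x = 0"
    using f by (metis Cc_infinityE)
  show ?thesis
  proof (rule Cc_infinityI[of _ "M + R"])
    fix x :: 'a assume x: "M + R < norm x"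
    have "norm (average Q f x) \<le> 0"
    proof (rule norm_average_le[OF Q])
      show "f \<in> borel_measurable borel"
        using f by (intro borel_measurable_continuous_onI Cc_infinity_continuous)
      fix w :: 'a assume "norm w \<le> R"
      then have "M < norm (x + w)"
        using x norm_diff_ineq[of x w] by linarith
      then show "norm (f (x + w)) \<le> 0"
        by (simp add: M)
    qed
    then show "average Q f x = 0" by simp
  qed (rule Ck[OF f])
qed

lemma divergence_average:
  fixes p :: "'a::euclidean_space \<Rightarrow> 'a"
  assumes Q: "averaging_kernel R Q" and p: "p \<in> Cc_infinity"
  shows "divergence (average Q p) x = average Q (divergence p) x"
proof -
  let ?p' = "\<lambda>y. frechet_derivative p (at y)"
  have int: "integrable lborel (\<lambda>w. Q w *\<^sub>R ?p' (x + w) b)" for b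
  proof -
    obtain B where "0 \<le> B" "\<And>x. norm (?p' x b) \<le> B"
      using Cc_infinity_bounded[OF Cc_infinity_derivative[OF p]] by metis
    then show ?thesis
      by (intro average_integrable[OF Q] borel_measurable_continuous_onI Cc_infinity_continuous
          Cc_infinity_derivative p)
  qed
  have "divergence (average Q p) x = (\<Sum>b\<in>Basis. average Q (\<lambda>y. ?p' y b) x \<bullet> b)"
    by (simp add: divergence_def frechet_derivative_at[OF average_has_derivative[OF Q p], symmetric])
  also have "\<dots> = (\<Sum>b\<in>Basis. \<integral>w. (Q w *\<^sub>R ?p' (x + w) b) \<bullet> b \<partial>lborel)"
    unfolding average_def by (intro sum.cong refl integral_inner_left[symmetric] int)
  also have "\<dots> = (\<integral>w. (\<Sum>b\<in>Basis. (Q w *\<^sub>R ?p' (x + w) b) \<bullet> b) \<partial>lborel)"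
    by (intro Bochner_Integration.integral_sum[symmetric] integrable_inner_left int)
  also have "\<dots> = average Q (divergence p) x"
    by (simp add: average_def divergence_def sum_distrib_left)
  finally show ?thesis .
qed

text \<open>
  The set where a continuous field exceeds the bound is open, and an open null set is empty.
\<close>

lemma admissible_field_norm_le:
  assumes "p \<in> admissible_fields"
  shows "norm (p x) \<le> 1"
proof -
  have cont: "continuous_on UNIV p" and ess: "esssup lebesgue (\<lambda>x. ereal (norm (p x))) \<le> 1"
    using assms Cc_infinity_continuous by (auto simp: admissible_fields_def)
  have "AE x in lebesgue. ereal (norm (p x)) \<le> 1"
    using esssup_AE[of "\<lambda>x. ereal (norm (p x))" lebesgue]
    by (rule eventually_mono) (rule order_trans[OF _ ess])
  moreover have opn: "open {x. 1 < norm (p x)}"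
    by (intro open_Collect_less continuous_intros cont)
  ultimately have "{x. 1 < norm (p x)} \<in> null_sets lebesgue"
    using AE_iff_null[of lebesgue "\<lambda>x. ereal (norm (p x)) \<le> 1"] by (simp add: not_le)
  then have "{x. 1 < norm (p x)} = {}"
    using opn open_not_negligible by (auto simp: negligible_iff_null_sets)
  then show ?thesis
    by (auto simp: not_less)
qed

text \<open>
  Averaging against a probability density of bounded support preserves smoothness and compact
  support and does not increase the supremum norm, so averages of competitors for the local
  total variation are again competitors.
\<close>

lemma average_admissible:
  assumes Q: "averaging_kernel R Q" and p: "p \<in> admissible_fields"
  shows "average Q p \<in> admissible_fields"
proof -
  have Cc: "p \<in> Cc_infinity" using p by (simp add: admissible_fields_def)
  note Cc' = average_Cc_infinity[OF Q Cc]
  have [measurable]: "average Q p \<in> borel_measurable borel" "p \<in> borel_measurable borel"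
    using Cc Cc' by (auto intro: borel_measurable_continuous_onI Cc_infinity_continuous)
  have "norm (average Q p x) \<le> 1" for x
    by (rule norm_average_le[OF Q]) (auto intro: admissible_field_norm_le p)
  then have "esssup lebesgue (\<lambda>x. ereal (norm (average Q p x))) \<le> 1"
    by (intro esssup_I) (auto intro!: measurable_completion)
  then show ?thesis
    using Cc' by (simp add: admissible_fields_def)
qed

section \<open>Radial potentials and the nonlocal divergence\<close>

text \<open>
  A radial function whose gradient is \<open>- k(|w|) w / |w|\<close>, vanishing outside the ball of radius
  \<open>R\<close>.
\<close>

definition radial_potential :: "real \<Rightarrow> (real \<Rightarrow> real) \<Rightarrow> 'a::euclidean_space \<Rightarrow> real" where
  "radial_potential R k w = integral {norm w..R} k"

text \<open>
  Profiles supported in the annulus \<open>\<delta> \<le> r \<le> R\<close>. Staying away from the origin makes the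
  potential constant near \<open>0\<close>, hence continuously differentiable everywhere, so that integration
  by parts applies without boundary terms.
\<close>

locale annular_profile =
  fixes k :: "real \<Rightarrow> real" and \<delta> R :: real
  assumes k: "continuous_on UNIV k" "\<And>r. 0 \<le> k r" "\<And>r. r \<le> \<delta> \<Longrightarrow> k r = 0" "\<And>r. R < r \<Longrightarrow> k r = 0"
    and \<delta>: "0 < \<delta>" "\<delta> < R"
begin

lemma profile_integrable: "k integrable_on {a..b}"
  by (rule integrable_continuous_real[OF continuous_on_subset[OF k(1)]]) simp

lemma radial_potential_profile_derivative:
  assumes "0 < s"
  shows "((\<lambda>s. integral {s..R} k) has_real_derivative - k s) (at s)"
proof -
  \<comment> \<open>Raising the upper limit beyond both \<open>s\<close> and \<open>R\<close> adds nothing to the integral and puts \<open>s\<close> in the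
    interior of the interval of integration, so that one argument covers \<open>s < R\<close> and \<open>s \<ge> R\<close>.\<close>
  define b where "b = max s R + 1"
  have zero: "integral {t..b} k = 0" if "R \<le> t" for t
  proof -
    have "integral {t..b} k = integral {t..b} (\<lambda>_. 0)"
      using that by (intro integral_spike[of "{R}"]) (auto simp: k(4))
    then show ?thesis by simp
  qed
  have eq: "integral {t..R} k = integral {t..b} k" if "t \<in> {0..b}" for t
  proof (cases "t \<le> R")
    case True
    then have "integral {t..b} k = integral {t..R} k + integral {R..b} k"
      by (intro Henstock_Kurzweil_Integration.integral_combine[symmetric] profile_integrable)
        (auto simp: b_def)
    then show ?thesis by (simp add: zero)
  next
    case False
    then show ?thesis by (simp add: zero)
  qed
  have "((\<lambda>t. integral {t..b} k) has_real_derivative - k s) (at s within {0..b})"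
    by (rule integral_has_real_derivative'[OF continuous_on_subset[OF k(1)]])
      (use assms in \<open>auto simp: b_def\<close>)
  moreover have "at s within {0..b} = at s"
    using assms by (intro at_within_interior) (auto simp: b_def)
  ultimately have "((\<lambda>t. integral {t..b} k) has_real_derivative - k s) (at s)"
    by simp
  then show ?thesis
    by (rule has_field_derivative_transform_within_open[of _ _ _ "{0<..<b}"])
      (use assms eq in \<open>auto simp: b_def\<close>)
qed

lemma radial_potential_nonneg: "0 \<le> radial_potential R k w"
  unfolding radial_potential_def by (intro integral_nonneg profile_integrable k)

lemma radial_potential_eq_0: "R < norm w \<Longrightarrow> radial_potential R k w = 0"
  by (simp add: radial_potential_def)

lemma radial_potential_near_0:
  assumes "norm w < \<delta>"
  shows "radial_potential R k w = integral {0..R} k"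
proof -
  have "integral {0..R} k = integral {0..norm w} k + integral {norm w..R} k"
    using assms \<delta>
    by (intro Henstock_Kurzweil_Integration.integral_combine[symmetric] profile_integrable) auto
  moreover have "integral {0..norm w} k = integral {0..norm w} (\<lambda>_. 0)"
    using assms by (intro integral_cong) (auto simp: k(3))
  ultimately show ?thesis
    by (simp add: radial_potential_def)
qed

lemma radial_potential_has_derivative:
  fixes w :: "'a::euclidean_space"
  shows "(radial_potential R k has_derivative (\<lambda>v. - (k (norm w) / norm w * (w \<bullet> v)))) (at w)"
proof (cases "w = 0")
  case True
  have "((\<lambda>w::'a. integral {0..R} k) has_derivative (\<lambda>v. 0)) (at w)"
    by simp
  then have "(radial_potential R k has_derivative (\<lambda>v. 0)) (at w)"
    by (rule has_derivative_transform_within_open[of _ _ _ _ "ball 0 \<delta>"])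
      (use True \<delta> in \<open>auto simp: radial_potential_near_0\<close>)
  then show ?thesis using True by simp
next
  case False
  have "((\<lambda>s. integral {s..R} k) has_derivative (*) (- k (norm w))) (at (norm w))"
    using radial_potential_profile_derivative[of "norm w"] False
    by (simp add: has_field_derivative_def)
  moreover have "(norm has_derivative (\<lambda>v. sgn w \<bullet> v)) (at w)"
    using has_derivative_norm[OF False] by (simp add: inner_commute)
  ultimately have "((\<lambda>w. integral {norm w..R} k) has_derivative (\<lambda>v. - k (norm w) * (sgn w \<bullet> v))) (at w)"
    by (rule has_derivative_compose[rotated])
  then show ?thesis
    by (simp add: radial_potential_def[abs_def] sgn_div_norm field_simps)
qed

lemma radial_potential_derivative_continuous:
  "continuous_on UNIV (\<lambda>w::'a::euclidean_space. - (k (norm w) / norm w * (w \<bullet> v)))"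
proof -
  \<comment> \<open>The two quotients differ only where \<open>k\<close> vanishes, and the second one has no singularity.\<close>
  have "k (norm w) / norm w = k (norm w) / max (norm w) \<delta>" for w :: 'a
    by (cases "norm w \<le> \<delta>") (auto simp: k(3))
  then have "(\<lambda>w::'a. - (k (norm w) / norm w * (w \<bullet> v)))
      = (\<lambda>w. - (k (norm w) / max (norm w) \<delta> * (w \<bullet> v)))"
    by presburger
  moreover have "continuous_on UNIV (\<lambda>w::'a. - (k (norm w) / max (norm w) \<delta> * (w \<bullet> v)))"
    using \<delta> by (intro continuous_intros continuous_on_compose2[OF k(1)]) (auto simp: max_def)
  ultimately show ?thesis by (simp only:)
qed

text \<open>
  Integration by parts against the identity field, whose divergence is the dimension.
\<close>

lemma radial_potential_mass:
  shows "integrable lborel (radial_potential R k :: 'a::euclidean_space \<Rightarrow> real)"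
    and "integrable lborel (\<lambda>w::'a. norm w * k (norm w))"
    and "real DIM('a) * (\<integral>w. radial_potential R k (w :: 'a) \<partial>lborel)
       = (\<integral>w. norm w * k (norm w) \<partial>(lborel :: 'a measure))"
proof -
  have cont: "continuous_on UNIV (radial_potential R k :: 'a \<Rightarrow> real)"
    by (rule has_derivative_continuous_on[where
          f' = "\<lambda>w v. - (k (norm w) / norm w * (w \<bullet> v))"]) (simp only: radial_potential_has_derivative)
  show "integrable lborel (radial_potential R k :: 'a \<Rightarrow> real)"
    by (rule integrable_continuous_compact_support[OF cont radial_potential_eq_0])
  have ibp: "integrable lborel (\<lambda>w::'a. (w \<bullet> b) * - (k (norm w) / norm w * (w \<bullet> b)))"
    "(\<integral>w. (b \<bullet> b) * radial_potential R k (w :: 'a) \<partial>lborel)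
      = - (\<integral>w. (w \<bullet> b) * - (k (norm w) / norm w * (w \<bullet> b)) \<partial>lborel)" for b :: 'a
    by (rule integration_by_parts_compact_support[where f' = "\<lambda>_ v. v \<bullet> b",
          OF _ _ radial_potential_has_derivative radial_potential_derivative_continuous
             radial_potential_eq_0]; auto intro!: derivative_eq_intros continuous_intros)+
  have sum_eq: "(\<Sum>b\<in>Basis. (w \<bullet> b) * (k (norm w) / norm w * (w \<bullet> b))) = norm w * k (norm w)" for w :: 'a
  proof -
    have "(\<Sum>b\<in>Basis. (w \<bullet> b) * (k (norm w) / norm w * (w \<bullet> b)))
        = k (norm w) / norm w * (w \<bullet> w)"
      by (simp add: euclidean_inner[of w w] sum_distrib_left algebra_simps)
    then show ?thesis
      by (simp add: dot_square_norm power2_eq_square)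
  qed
  have int: "integrable lborel (\<lambda>w::'a. (w \<bullet> b) * (k (norm w) / norm w * (w \<bullet> b)))" for b :: 'a
    using ibp(1)[of b] by simp
  have "integrable lborel (\<lambda>w::'a. \<Sum>b\<in>Basis. (w \<bullet> b) * (k (norm w) / norm w * (w \<bullet> b)))"
    by (intro Bochner_Integration.integrable_sum int)
  then show "integrable lborel (\<lambda>w::'a. norm w * k (norm w))"
    by (simp only: sum_eq)
  have "(\<integral>w. norm w * k (norm w) \<partial>(lborel :: 'a measure))
      = (\<integral>w. (\<Sum>b\<in>Basis. (w \<bullet> b) * (k (norm w) / norm w * (w \<bullet> b))) \<partial>(lborel :: 'a measure))"
    by (simp only: sum_eq)
  also have "\<dots> = (\<Sum>b\<in>Basis. \<integral>w. (w \<bullet> b) * (k (norm w) / norm w * (w \<bullet> b)) \<partial>(lborel :: 'a measure))"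
    by (intro Bochner_Integration.integral_sum int)
  also have "\<dots> = (\<Sum>b\<in>(Basis::'a set). \<integral>w. radial_potential R k (w :: 'a) \<partial>lborel)"
  proof (intro sum.cong refl)
    fix b :: 'a assume "b \<in> Basis"
    then show "(\<integral>w. (w \<bullet> b) * (k (norm w) / norm w * (w \<bullet> b)) \<partial>lborel)
        = (\<integral>w. radial_potential R k (w :: 'a) \<partial>lborel)"
      using ibp(2)[of b] by (simp add: inner_same_Basis)
  qed
  finally show "real DIM('a) * (\<integral>w. radial_potential R k (w :: 'a) \<partial>lborel)
       = (\<integral>w. norm w * k (norm w) \<partial>(lborel :: 'a measure))"
    by simp
qed

text \<open>
  Integration by parts moves the divergence onto the potential and produces
  \<open>p (x + w) \<bullet> w k(|w|) / |w|\<close>. Replacing \<open>p (x + w)\<close> by \<open>p (x + w) - p x\<close> is free, because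
  the subtracted term is odd in \<open>w\<close>.
\<close>

lemma radial_potential_divergence:
  fixes p :: "'a::euclidean_space \<Rightarrow> 'a"
  assumes p: "p \<in> Cc_infinity"
  shows "(\<integral>w. radial_potential R k w * divergence p (x + w) \<partial>lborel)
    = (\<integral>w. ((p (x + w) - p x) \<bullet> w) * (k (norm w) / norm w) \<partial>lborel)"
proof -
  let ?p' = "\<lambda>x. frechet_derivative p (at x)"
  have der: "((\<lambda>w. p (x + w) \<bullet> b) has_derivative (\<lambda>v. ?p' (x + w) v \<bullet> b)) (at w)" for w b
    by (rule has_derivative_inner_left,
        rule has_derivative_compose[OF _ Cc_infinity_has_derivative[OF p]])
       (auto intro!: derivative_eq_intros)
  have cont: "continuous_on UNIV (\<lambda>w. ?p' (x + w) v \<bullet> b)" for v b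
    by (intro continuous_intros continuous_on_compose2[OF
          Cc_infinity_continuous[OF Cc_infinity_derivative[OF p]]]) auto
  note ibp = integration_by_parts_compact_support[OF der cont radial_potential_has_derivative
      radial_potential_derivative_continuous radial_potential_eq_0]
  let ?m = "\<lambda>w::'a. k (norm w) / norm w"
  have int: "integrable lborel (\<lambda>w. (p (x + w) \<bullet> b) * (?m w * (w \<bullet> b)))" for b
  proof -
    have "integrable lborel (\<lambda>w. (p (x + w) \<bullet> b) * - (?m w * (w \<bullet> b)))"
      by (rule ibp(2))
    then show ?thesis by simp
  qed
  have sum_eq: "(\<Sum>b\<in>Basis. (y \<bullet> b) * (?m w * (w \<bullet> b))) = (y \<bullet> w) * ?m w" for y w :: 'a
    by (simp add: euclidean_inner[of y w] sum_distrib_left sum_distrib_right algebra_simps)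
  have int': "integrable lborel (\<lambda>w. (p (x + w) \<bullet> w) * ?m w)"
  proof -
    have "integrable lborel (\<lambda>w. \<Sum>b\<in>Basis. (p (x + w) \<bullet> b) * (?m w * (w \<bullet> b)))"
      by (intro Bochner_Integration.integrable_sum int)
    then show ?thesis by (simp only: sum_eq)
  qed
  have cont_m: "continuous_on UNIV (\<lambda>w. (p x \<bullet> w) * ?m w)"
    using continuous_on_minus[OF radial_potential_derivative_continuous[of "p x"]]
    by (simp add: inner_commute mult.commute)
  have int_odd: "integrable lborel (\<lambda>w. (p x \<bullet> w) * ?m w)"
    by (rule integrable_continuous_compact_support[OF cont_m, of R]) (simp add: k(4))
  have odd: "(\<integral>w. (p x \<bullet> w) * ?m w \<partial>lborel) = 0"
    by (rule lborel_integral_odd[OF borel_measurable_continuous_onI[OF cont_m]]) simp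
  have "(\<integral>w. radial_potential R k w * divergence p (x + w) \<partial>lborel)
      = (\<integral>w. (\<Sum>b\<in>Basis. (?p' (x + w) b \<bullet> b) * radial_potential R k w) \<partial>lborel)"
    by (simp add: divergence_def sum_distrib_left mult.commute)
  also have "\<dots> = (\<Sum>b\<in>Basis. \<integral>w. (?p' (x + w) b \<bullet> b) * radial_potential R k w \<partial>lborel)"
    by (intro Bochner_Integration.integral_sum ibp(1))
  also have "\<dots> = (\<Sum>b\<in>Basis. \<integral>w. (p (x + w) \<bullet> b) * (?m w * (w \<bullet> b)) \<partial>lborel)"
    by (intro sum.cong refl) (simp add: ibp(3))
  also have "\<dots> = (\<integral>w. (p (x + w) \<bullet> w) * ?m w \<partial>lborel)"
    by (subst Bochner_Integration.integral_sum[symmetric, OF int]) (simp only: sum_eq)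
  also have "\<dots> = (\<integral>w. ((p (x + w) - p x) \<bullet> w) * ?m w \<partial>lborel)"
    by (simp only: inner_diff_left left_diff_distrib
        Bochner_Integration.integral_diff[OF int' int_odd] odd diff_zero)
  finally show ?thesis .
qed

end

lemma nonlocal_div_lborel:
  fixes rho :: "'a::euclidean_space \<Rightarrow> real"
  assumes [measurable]: "rho \<in> borel_measurable borel" and p: "p \<in> Cc_infinity"
  shows "nonlocal_div rho p x
    = (\<integral>w. ((p (x + w) - p x) \<bullet> w) / norm w ^ 2 * rho w \<partial>lborel)"
proof -
  have [measurable]: "p \<in> borel_measurable borel"
    using p by (intro borel_measurable_continuous_onI Cc_infinity_continuous)
  let ?f = "\<lambda>y. (((p y - p x) /\<^sub>R norm (y - x)) \<bullet> ((y - x) /\<^sub>R norm (y - x))) * rho (y - x)"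
  have [measurable]: "?f \<in> borel_measurable borel"
    by measurable
  have "nonlocal_div rho p x = (\<integral>y. ?f y \<partial>lborel)"
    unfolding nonlocal_div_def by (rule integral_completion) simp
  also have "\<dots> = (\<integral>w. ?f (x + w) \<partial>lborel)"
    by (rule lborel_integral_translate[symmetric]) measurable
  finally show ?thesis
    by (simp add: power2_eq_square divide_inverse mult_ac)
qed

text \<open>
  The nonlocal divergence is an average of the classical one. The density is the potential \<open>Q\<close>
  of the profile \<open>q(r) / r\<close>. This profile is too singular at the origin for a direct integration
  by parts, so it is cut off to the annulus \<open>\<delta> n \<le> r \<le> R\<close> and \<open>\<delta> n\<close> is sent to zero: the
  truncated potentials increase to \<open>Q\<close>, their masses converge to \<open>\<integral> rho / d = 1\<close>, and the two
  sides of the identity converge by dominated convergence, with majorants given by a bound on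
  \<open>div p\<close> and by the Lipschitz constant of \<open>p\<close>.
\<close>

lemma nonlocal_div_eq_average_divergence:
  fixes rho :: "'a::euclidean_space \<Rightarrow> real"
  assumes q: "continuous_on {0<..} q" "\<And>r. 0 < r \<Longrightarrow> 0 \<le> q r" "\<And>r. R < r \<Longrightarrow> q r = 0" and R: "0 < R"
    and rho: "\<And>z. z \<noteq> 0 \<Longrightarrow> rho z = q (norm z)" "integrable lborel rho"
      "(\<integral>z. rho z \<partial>lborel) = real DIM('a)"
  obtains Q where "averaging_kernel R Q"
    "\<And>p x. p \<in> Cc_infinity \<Longrightarrow> nonlocal_div rho p x = average Q (divergence p) x"
proof -
  define \<delta> where "\<delta> n = R / (real n + 2)" for n
  have \<delta>: "0 < \<delta> n" "\<delta> n < R" "m \<le> n \<Longrightarrow> \<delta> n \<le> \<delta> m" for m n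
    using R by (auto simp: \<delta>_def field_simps intro: add_pos_nonneg)
  have \<delta>_lim: "\<delta> \<longlonglongrightarrow> 0"
    unfolding \<delta>_def by real_asymp
  \<comment> \<open>On \<open>r > 0\<close> this is \<open>q r / r\<close> times a ramp that rises from \<open>0\<close> at \<open>\<delta> n\<close> to \<open>1\<close> at \<open>2 * \<delta> n\<close>.
    Evaluating \<open>q r / r\<close> at \<open>max r (\<delta> n)\<close> makes the formula continuous on the whole line.\<close>
  define k where "k n r = max 0 (min 1 (r / \<delta> n - 1)) * (q (max r (\<delta> n)) / max r (\<delta> n))" for n r
  have k0: "k n r = 0" if "r \<le> \<delta> n" for n r
  proof -
    have "r / \<delta> n \<le> 1"
      using that \<delta>(1)[of n] by simp
    then show ?thesis by (simp add: k_def)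
  qed
  have kpos: "k n r = max 0 (min 1 (r / \<delta> n - 1)) * (q r / r)" if "0 < r" for n r
  proof (cases "r \<le> \<delta> n")
    case True
    then have "r / \<delta> n \<le> 1"
      using \<delta>(1)[of n] by simp
    then show ?thesis
      using True by (simp add: k0)
  qed (simp add: k_def max_absorb1)
  have knn: "0 \<le> k n r" for n r
    using q(2)[of "max r (\<delta> n)"] \<delta>(1)[of n] by (auto simp: k_def max_def)
  have kR: "k n r = 0" if "R < r" for n r
    using that R by (simp add: kpos q)
  have kcont: "continuous_on UNIV (k n)" for n
    unfolding k_def using \<delta>(1)[of n]
    by (intro continuous_intros continuous_on_compose2[OF q(1)]) (auto simp: max_def)
  have kle: "k n r \<le> q r / r" if "0 < r" for n r
    unfolding kpos[OF that] using that q(2)[OF that] by (intro mult_left_le_one_le) auto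
  have kmono: "k m r \<le> k n r" if "m \<le> n" for m n r
  proof (cases "0 < r")
    case True
    have "r / \<delta> m \<le> r / \<delta> n"
      using \<delta> that True by (intro divide_left_mono) auto
    then show ?thesis
      unfolding kpos[OF True] using True q(2)[OF True] by (intro mult_right_mono) auto
  next
    case False
    then show ?thesis using \<delta>(1)[of m] \<delta>(1)[of n] by (simp add: k0)
  qed
  have kev: "\<forall>\<^sub>F n in sequentially. \<forall>r\<ge>s. k n r = q r / r" if "0 < s" for s
  proof -
    have "\<forall>\<^sub>F n in sequentially. \<delta> n < s / 2"
      by (rule order_tendstoD(2)[OF \<delta>_lim]) (use that in simp)
    then show ?thesis
    proof eventually_elim
      case (elim n)
      show ?case
      proof (intro allI impI)
        fix r assume "s \<le> r"
        then have "1 \<le> r / \<delta> n - 1" "0 < r"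
          using elim \<delta>(1)[of n] that by (auto simp: field_simps)
        then show "k n r = q r / r" by (simp add: kpos)
      qed
    qed
  qed
  define P where "P n = (radial_potential R (k n) :: 'a \<Rightarrow> real)" for n
  interpret annular_profile "k n" "\<delta> n" R for n
    by unfold_locales (simp_all add: kcont knn k0 kR \<delta>)
  have P_nonneg: "0 \<le> P n w" for n w
    unfolding P_def by (rule radial_potential_nonneg)
  note P_mass = radial_potential_mass[where 'a = 'a, folded P_def]
  note P_div = radial_potential_divergence[where 'a = 'a, folded P_def]
  \<comment> \<open>The truncated potentials may diverge at the origin, where a finite value is put by hand; elsewhere
    they are eventually constant in \<open>n\<close>.\<close>
  define Q where "Q w = (if w = 0 then 0 else radial_potential R (\<lambda>r. q r / r) w)" for w :: 'a
  have P_mono: "P m w \<le> P n w" if "m \<le> n" for m n w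
    unfolding P_def radial_potential_def
    by (intro integral_le profile_integrable kmono that)
  have P_ev: "\<forall>\<^sub>F n in sequentially. P n w = Q w" if "w \<noteq> 0" for w
    using kev[of "norm w"] that
    by (auto elim!: eventually_mono simp: P_def Q_def radial_potential_def intro!: integral_cong)
  have P_le: "P n w \<le> Q w" if nz: "w \<noteq> 0" for n w
  proof -
    obtain m where "m \<ge> n" "P m w = Q w"
      using P_ev[OF nz] unfolding eventually_sequentially by (meson nat_le_linear)
    then show ?thesis using P_mono[of n m w] by simp
  qed
  have P_lim: "(\<lambda>n. P n w) \<longlonglongrightarrow> Q w" if "w \<noteq> 0" for w
    using P_ev[OF that] by (rule tendsto_eventually)
  have [measurable]: "rho \<in> borel_measurable borel"
    using borel_measurable_integrable[OF rho(2)] by simp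
  have [measurable]: "k n \<in> borel_measurable borel" for n
    by (rule borel_measurable_continuous_onI[OF kcont])
  have [measurable]: "P n \<in> borel_measurable borel" for n
    using borel_measurable_integrable[OF P_mass(1)] by simp
  have [measurable]: "Q \<in> borel_measurable borel"
  proof (rule borel_measurable_LIMSEQ_real)
    show "(\<lambda>n. if w = 0 then 0 else P n w) \<longlonglongrightarrow> Q w" for w
      using P_lim[of w] by (cases "w = 0") (auto simp: Q_def)
    show "(\<lambda>w. if w = 0 then 0 else P n w) \<in> borel_measurable borel" for n
      by measurable
  qed
  have AE_nz: "AE w in lborel. w \<noteq> (0::'a)"
    by (rule AE_lborel_singleton)
  have klim: "(\<lambda>n. k n (norm w)) \<longlonglongrightarrow> rho w / norm w" if "w \<noteq> 0" for w :: 'a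
    using kev[of "norm w"] that
    by (intro tendsto_eventually) (auto elim!: eventually_mono simp: rho(1))
  have kle': "norm w * k n (norm w) \<le> rho w" if "w \<noteq> 0" for n and w :: 'a
    using kle[of "norm w" n] that by (simp add: rho(1) field_simps)
  have "(\<lambda>n. \<integral>w. norm w * k n (norm w) \<partial>(lborel :: 'a measure)) \<longlonglongrightarrow> (\<integral>w. rho w \<partial>lborel)"
  proof (rule integral_dominated_convergence[where w = rho])
    show "AE w in lborel. (\<lambda>n. norm w * k n (norm w)) \<longlonglongrightarrow> rho w"
      using AE_nz by eventually_elim (auto intro!: tendsto_eq_intros klim)
    show "AE w in lborel. norm (norm w * k n (norm (w::'a))) \<le> rho w" for n
      using AE_nz by eventually_elim (simp add: kle' knn)
  qed (use rho in auto)
  then have "(\<lambda>n. (\<integral>w. norm w * k n (norm w) \<partial>(lborel :: 'a measure)) / real DIM('a)) \<longlonglongrightarrow> 1"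
    by (auto intro!: tendsto_eq_intros simp: rho(3))
  moreover have "(\<integral>w. norm w * k n (norm w) \<partial>(lborel :: 'a measure)) / real DIM('a) = (\<integral>w. P n w \<partial>lborel)" for n
    using P_mass(3)[of n] by (simp add: field_simps)
  ultimately have mass_lim: "(\<lambda>n. \<integral>w. P n w \<partial>lborel) \<longlonglongrightarrow> 1"
    by simp
  have "AE w in lborel. (\<lambda>n. P n w) \<longlonglongrightarrow> Q w"
    using AE_nz by eventually_elim (rule P_lim)
  then have Q_int: "integrable lborel Q" "(\<integral>w. Q w \<partial>lborel) = 1"
    using integral_monotone_convergence_nonneg[where f = P and u = Q, OF P_mass(1) _ _ _ mass_lim]
    by (auto simp: mono_def P_mono P_nonneg)
  have Q: "averaging_kernel R Q"
    unfolding averaging_kernel_def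
  proof (intro conjI allI impI Q_int)
    show "0 \<le> Q w" for w
      using P_le[of w 0] P_nonneg[of 0 w] by (cases "w = 0") (auto simp: Q_def)
    show "Q w = 0" if "R < norm w" for w
      using that by (simp add: Q_def radial_potential_def)
  qed
  have "nonlocal_div rho p x = average Q (divergence p) x" if p: "p \<in> Cc_infinity" for p x
  proof -
    obtain B where B: "0 \<le> B" "\<And>x. \<bar>divergence p x\<bar> \<le> B" and cont: "continuous_on UNIV (divergence p)"
      using p by (metis divergence_regular)
    obtain L where L: "0 \<le> L" "\<And>x y. norm (p x - p y) \<le> L * norm (x - y)"
      using p by (metis Cc_infinity_lipschitz)
    have [measurable]: "divergence p \<in> borel_measurable borel"
      by (rule borel_measurable_continuous_onI[OF cont])
    have [measurable]: "p \<in> borel_measurable borel"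
      using p by (intro borel_measurable_continuous_onI Cc_infinity_continuous)
    have "(\<lambda>n. \<integral>w. P n w * divergence p (x + w) \<partial>lborel)
        \<longlonglongrightarrow> (\<integral>w. Q w * divergence p (x + w) \<partial>lborel)"
    proof (rule integral_dominated_convergence[where w = "\<lambda>w. Q w * B"])
      show "AE w in lborel. (\<lambda>n. P n w * divergence p (x + w)) \<longlonglongrightarrow> Q w * divergence p (x + w)"
        using AE_nz by eventually_elim (auto intro!: tendsto_intros P_lim)
      show "AE w in lborel. norm (P n w * divergence p (x + w)) \<le> Q w * B" for n
        using AE_nz
      proof eventually_elim
        case (elim w)
        then show ?case
          using P_le[of w n] P_nonneg[of n w] B
          by (auto simp: abs_mult intro!: mult_mono)
      qed
    qed (use Q_int in auto)
    moreover have "(\<lambda>n. \<integral>w. ((p (x + w) - p x) \<bullet> w) * (k n (norm w) / norm w) \<partial>lborel)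
        \<longlonglongrightarrow> (\<integral>w. ((p (x + w) - p x) \<bullet> w) / norm w ^ 2 * rho w \<partial>lborel)"
    proof (rule integral_dominated_convergence[where w = "\<lambda>w. L * rho w"])
      show "AE w in lborel. (\<lambda>n. ((p (x + w) - p x) \<bullet> w) * (k n (norm w) / norm w))
          \<longlonglongrightarrow> ((p (x + w) - p x) \<bullet> w) / norm w ^ 2 * rho w"
        using AE_nz
      proof eventually_elim
        case (elim w)
        have "(\<lambda>n. ((p (x + w) - p x) \<bullet> w) * (k n (norm w) / norm w))
            \<longlonglongrightarrow> ((p (x + w) - p x) \<bullet> w) * (rho w / norm w / norm w)"
          using elim by (intro tendsto_intros klim) auto
        then show ?case by (simp add: power2_eq_square)
      qed
      show "AE w in lborel. norm (((p (x + w) - p x) \<bullet> w) * (k n (norm w) / norm w)) \<le> L * rho w" for n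
        using AE_nz
      proof eventually_elim
        case (elim w)
        have "\<bar>(p (x + w) - p x) \<bullet> w\<bar> \<le> norm (p (x + w) - p x) * norm w"
          by (rule Cauchy_Schwarz_ineq2)
        also have "\<dots> \<le> (L * norm w) * norm w"
          using L(2)[of "x + w" x] by (intro mult_right_mono) auto
        finally have "\<bar>(p (x + w) - p x) \<bullet> w\<bar> * (k n (norm w) / norm w)
            \<le> (L * norm w * norm w) * (k n (norm w) / norm w)"
          by (intro mult_right_mono) (simp_all add: knn)
        also have "\<dots> = L * (norm w * k n (norm w))"
          using elim by simp
        also have "\<dots> \<le> L * rho w"
          using L elim by (intro mult_left_mono kle')
        finally show ?case by (simp add: abs_mult knn)
      qed
    qed (use rho in auto)
    ultimately have "(\<integral>w. Q w * divergence p (x + w) \<partial>lborel)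
        = (\<integral>w. ((p (x + w) - p x) \<bullet> w) / norm w ^ 2 * rho w \<partial>lborel)"
      unfolding P_div[OF p] by (rule LIMSEQ_unique)
    then show ?thesis
      by (simp add: nonlocal_div_lborel p average_def)
  qed
  then show ?thesis using that Q by blast
qed

section \<open>Gamma-convergence of the nonlocal total variations\<close>

lemma L1_loc_diff:
  assumes "u \<in> L1_loc" "v \<in> L1_loc"
  shows "(\<lambda>x. v x - u x) \<in> L1_loc"
  using assms by (auto simp: L1_loc_def intro!: set_integral_diff)

lemma L1_loc_pairing:
  fixes u g :: "'a::euclidean_space \<Rightarrow> real"
  assumes u: "u \<in> L1_loc" and g: "continuous_on UNIV g" "\<And>x. \<bar>g x\<bar> \<le> B" "\<And>x. M < norm x \<Longrightarrow> g x = 0"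
  shows "integrable lebesgue (\<lambda>x. u x * g x)"
    and "\<bar>LINT x|lebesgue. u x * g x\<bar> \<le> B * (LINT x:cball 0 M|lebesgue. \<bar>u x\<bar>)"
proof -
  have abs: "set_integrable lebesgue (cball 0 M) (\<lambda>x. \<bar>u x\<bar>)"
    and uint: "integrable lebesgue (\<lambda>x. indicator (cball 0 M) x * u x)"
  proof -
    have "set_integrable lebesgue (cball 0 M) u"
      using u by (simp add: L1_loc_def)
    then show "set_integrable lebesgue (cball 0 M) (\<lambda>x. \<bar>u x\<bar>)"
      "integrable lebesgue (\<lambda>x. indicator (cball 0 M) x * u x)"
      using set_integrable_abs by (auto simp: set_integrable_def)
  qed
  then have intB: "integrable lebesgue (\<lambda>x. B * (indicator (cball 0 M) x * \<bar>u x\<bar>))"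
    by (simp add: set_integrable_def)
  have [measurable]: "g \<in> borel_measurable lebesgue"
    using borel_measurable_continuous_onI[OF g(1)] by (simp add: measurable_completion)
  have eq: "u x * g x = (indicator (cball 0 M) x * u x) * g x" for x
    using g(3)[of x] by (auto simp: indicator_def)
  have bound: "\<bar>u x * g x\<bar> \<le> B * (indicator (cball 0 M) x * \<bar>u x\<bar>)" for x
  proof -
    have "\<bar>u x * g x\<bar> = (indicator (cball 0 M) x * \<bar>u x\<bar>) * \<bar>g x\<bar>"
      by (subst eq) (simp add: abs_mult)
    also have "\<dots> \<le> (indicator (cball 0 M) x * \<bar>u x\<bar>) * B"
      by (intro mult_left_mono g(2)) simp
    finally show ?thesis by (simp add: mult.commute)
  qed
  show int: "integrable lebesgue (\<lambda>x. u x * g x)"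
  proof (rule Bochner_Integration.integrable_bound[OF intB])
    show "(\<lambda>x. u x * g x) \<in> borel_measurable lebesgue"
      unfolding eq using borel_measurable_integrable[OF uint] by measurable
    show "AE x in lebesgue. norm (u x * g x) \<le> norm (B * (indicator (cball 0 M) x * \<bar>u x\<bar>))"
      using bound by (auto intro!: AE_I2 intro: order_trans[OF _ abs_ge_self])
  qed
  have "\<bar>LINT x|lebesgue. u x * g x\<bar> \<le> (LINT x|lebesgue. B * (indicator (cball 0 M) x * \<bar>u x\<bar>))"
    by (rule integral_abs_bound_integral[OF int intB bound])
  also have "\<dots> = B * (LINT x:cball 0 M|lebesgue. \<bar>u x\<bar>)"
    by (simp add: set_lebesgue_integral_def)
  finally show "\<bar>LINT x|lebesgue. u x * g x\<bar> \<le> B * (LINT x:cball 0 M|lebesgue. \<bar>u x\<bar>)" .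
qed

text \<open>
  Testing \<open>u\<close> against the nonlocal divergence of \<open>p\<close> is testing it against the classical
  divergence of the averaged field, which is a competitor for \<open>TV u\<close>.
\<close>

lemma nonlocal_TV_le_TV:
  assumes Q: "averaging_kernel R Q"
    and eq: "\<And>p x. p \<in> Cc_infinity \<Longrightarrow> nonlocal_div rho p x = average Q (divergence p) x"
  shows "nonlocal_TV rho u \<le> TV u"
  unfolding nonlocal_TV_def
proof (rule SUP_least)
  fix p :: "'a \<Rightarrow> 'a" assume p: "p \<in> admissible_fields"
  then have Cc: "p \<in> Cc_infinity" by (simp add: admissible_fields_def)
  show "ereal (LINT x|lebesgue. u x * nonlocal_div rho p x) \<le> TV u"
    unfolding TV_def
    by (rule SUP_upper2[OF average_admissible[OF Q p]])
       (simp add: eq[OF Cc] divergence_average[OF Q Cc])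
qed

text \<open>
  Rescaling preserves the total mass and shrinks the support to the ball of radius \<open>\<epsilon>\<close>, so each
  rescaled kernel has its own averaging density. The profile is continuous away from the origin
  because it is a power of \<open>r\<close> times a smooth function.
\<close>

lemma rescaled_kernel_average:
  fixes rho :: "'a::euclidean_space \<Rightarrow> real"
  assumes adm: "admissible_kernel rho"
    and mass: "(LINT z|lebesgue. rho z) = real DIM('a)"
    and supp: "closure {z. z \<noteq> 0 \<and> rho z \<noteq> 0} = cball 0 1"
    and \<epsilon>: "0 < \<epsilon>"
  obtains Q where "averaging_kernel \<epsilon> Q"
    "\<And>p x. p \<in> Cc_infinity \<Longrightarrow> nonlocal_div (rescaled_kernel rho \<epsilon>) p x = average Q (divergence p) x"
proof -
  obtain q where q: "\<And>z. z \<noteq> 0 \<Longrightarrow> rho z = q (norm z)"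
    and smooth: "\<And>k r. 0 < r \<Longrightarrow> (deriv ^^ k) (\<lambda>r. r powr (real DIM('a) - 2) * q r) differentiable (at r)"
    using adm unfolding admissible_kernel_def Let_def by blast
  have nonneg: "0 \<le> rho z" if "z \<noteq> 0" for z
    using adm that by (simp add: admissible_kernel_def)
  obtain b :: 'a where "b \<in> Basis" using nonempty_Basis by blast
  then have b: "norm b = 1" "b \<noteq> 0" by auto
  have q_eq: "q r = rho (r *\<^sub>R b)" if "0 < r" for r
    using q[of "r *\<^sub>R b"] that b by simp
  have q_nonneg: "0 \<le> q r" if "0 < r" for r
    using nonneg[of "r *\<^sub>R b"] that b by (auto simp: q_eq)
  have q_supp: "q r = 0" if "1 < r" for r
  proof -
    have "r *\<^sub>R b \<notin> closure {z. z \<noteq> 0 \<and> rho z \<noteq> 0}"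
      using that b by (simp add: supp)
    then have "r *\<^sub>R b \<notin> {z. z \<noteq> 0 \<and> rho z \<noteq> 0}"
      using subsetD[OF closure_subset] by metis
    then show ?thesis using that b by (auto simp: q_eq)
  qed
  have q_cont: "continuous_on {0<..} q"
  proof -
    have cont: "continuous_on {0<..} (\<lambda>r. r powr (real DIM('a) - 2) * q r)"
      using smooth[of _ 0]
      by (auto intro!: continuous_at_imp_continuous_on differentiable_imp_continuous_within)
    \<comment> \<open>Multiplying by the opposite power recovers \<open>q\<close>.\<close>
    have "continuous_on {0<..} (\<lambda>r. r powr (2 - real DIM('a)) * (r powr (real DIM('a) - 2) * q r))"
      by (rule continuous_on_mult[OF _ cont]) (intro continuous_intros; simp)
    then show ?thesis
      by (rule continuous_on_eq) (simp flip: mult.assoc powr_add)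
  qed
  have "continuous_on (- {0}) (\<lambda>z::'a. q (norm z))"
    by (intro continuous_on_compose2[OF q_cont] continuous_intros) auto
  then have "continuous_on (- {0}) rho"
    by (rule continuous_on_eq) (simp add: q)
  then have [measurable]: "rho \<in> borel_measurable borel"
    by (intro borel_measurable_continuous_countable_exceptions[of "{0}"]) auto
  let ?r = "rescaled_kernel rho \<epsilon>"
  have [measurable]: "?r \<in> borel_measurable borel"
    unfolding rescaled_kernel_def[abs_def] by measurable
  have "(\<integral>z. ?r z \<partial>lborel) = (\<integral>z. rho z \<partial>lborel)"
    using lborel_integral_affine[of ?r \<epsilon> 0] \<epsilon> by (simp add: rescaled_kernel_def)
  also have "\<dots> = (LINT z|lebesgue. rho z)"
    by (rule integral_completion[symmetric]) simp
  finally have mass': "(\<integral>z. ?r z \<partial>lborel) = real DIM('a)"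
    by (simp add: mass)
  then have int': "integrable lborel ?r"
    using not_integrable_integral_eq[of lborel ?r] by force
  show ?thesis
  proof (rule nonlocal_div_eq_average_divergence[of "\<lambda>r. q (r / \<epsilon>) / \<epsilon> ^ DIM('a)" \<epsilon> ?r])
    show "continuous_on {0<..} (\<lambda>r. q (r / \<epsilon>) / \<epsilon> ^ DIM('a))"
      using \<epsilon> by (intro continuous_intros continuous_on_compose2[OF q_cont]) auto
    show "0 \<le> q (r / \<epsilon>) / \<epsilon> ^ DIM('a)" if "0 < r" for r
      using that \<epsilon> by (simp add: q_nonneg)
    show "q (r / \<epsilon>) / \<epsilon> ^ DIM('a) = 0" if "\<epsilon> < r" for r
      using that \<epsilon> by (simp add: q_supp)
    show "?r z = q (norm z / \<epsilon>) / \<epsilon> ^ DIM('a)" if "z \<noteq> 0" for z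
      using that \<epsilon> q[of "z /\<^sub>R \<epsilon>"] by (simp add: rescaled_kernel_def divide_inverse mult.commute)
  qed (fact \<epsilon> int' mass' that)+
qed

text \<open>
  Averages over balls of radius \<open>e n\<close> converge uniformly to the Lipschitz function \<open>div p\<close>, at
  rate \<open>L e n\<close>, and all supports lie in one compact set \<open>K\<close> as soon as \<open>e n < 1\<close>. Hence
  the absolute value of
  \<open>\<integral> v\<^sub>n D\<^sub>n - \<integral> u div p = \<integral> (v\<^sub>n - u) D\<^sub>n + \<integral> u (D\<^sub>n - div p)\<close> is at most
  \<open>B \<integral>\<^sub>K |v\<^sub>n - u| + L e\<^sub>n \<integral>\<^sub>K |u|\<close>.
\<close>

lemma pairing_nonlocal_div_tendsto:
  fixes rho :: "'a::euclidean_space \<Rightarrow> real"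
  assumes Q: "\<And>n. 0 < e n \<Longrightarrow> averaging_kernel (e n) (Q n)"
    and eq: "\<And>n x. 0 < e n \<Longrightarrow> D n x = average (Q n) (divergence p) x"
    and e: "filterlim e (at_right 0) sequentially"
    and v: "\<And>n. v n \<in> L1_loc" "limitin L1_loc_topology v u sequentially"
    and p: "p \<in> (Cc_infinity :: ('a \<Rightarrow> 'a) set)"
  shows "(\<lambda>n. LINT x|lebesgue. v n x * D n x) \<longlonglongrightarrow> (LINT x|lebesgue. u x * divergence p x)"
proof -
  obtain L B where L: "0 \<le> L" "\<And>x y. \<bar>divergence p x - divergence p y\<bar> \<le> L * norm (x - y)"
    and B: "0 \<le> B" "\<And>x. \<bar>divergence p x\<bar> \<le> B" and cont: "continuous_on UNIV (divergence p)"
    using p by (metis divergence_regular)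
  obtain M where "0 < M" and M: "\<And>x. M < norm x \<Longrightarrow> p x = 0"
    using p by (metis Cc_infinityE)
  let ?K = "cball 0 (M + 1) :: 'a set"
  let ?I = "\<lambda>n. LINT x:?K|lebesgue. \<bar>v n x - u x\<bar>"
  let ?J = "LINT x:?K|lebesgue. \<bar>u x\<bar>"
  have u: "u \<in> L1_loc" and lim: "?I \<longlonglongrightarrow> 0"
    using v(2) by (auto simp: limitin_L1_loc_topology)
  have e0: "e \<longlonglongrightarrow> 0" and epos: "\<forall>\<^sub>F n in sequentially. 0 < e n"
    using e by (auto simp: filterlim_at elim: eventually_mono)
  have "(\<lambda>n. (LINT x|lebesgue. v n x * D n x) - (LINT x|lebesgue. u x * divergence p x)) \<longlonglongrightarrow> 0"
  proof (rule Lim_null_comparison)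
    show "(\<lambda>n. B * ?I n + (L * e n) * ?J) \<longlonglongrightarrow> 0"
      using lim e0 by (auto intro!: tendsto_eq_intros)
    have "\<forall>\<^sub>F n in sequentially. e n < 1"
      using order_tendstoD(2)[OF e0] by simp
    with epos show "\<forall>\<^sub>F n in sequentially.
        norm ((LINT x|lebesgue. v n x * D n x) - (LINT x|lebesgue. u x * divergence p x))
        \<le> B * ?I n + (L * e n) * ?J"
    proof eventually_elim
      case (elim n)
      note Qn = Q[OF elim(1)]
      note Cc = average_Cc_infinity[OF Qn p]
      have D_avg: "D n = average (Q n) (divergence p)"
        by (rule ext) (rule eq[OF elim(1)])
      have D_div: "D n = divergence (average (Q n) p)"
        by (rule ext) (simp add: D_avg divergence_average[OF Qn p])
      have meas: "divergence p \<in> borel_measurable borel"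
        by (rule borel_measurable_continuous_onI[OF cont])
      have D_cont: "continuous_on UNIV (D n)"
        unfolding D_div using Cc by (metis divergence_regular)
      have D_le: "\<bar>D n x\<bar> \<le> B" for x
        using norm_average_le[OF Qn meas, of x B] B by (simp add: D_avg)
      have D_close: "\<bar>D n x - divergence p x\<bar> \<le> L * e n" for x
        using average_lipschitz_close[OF Qn meas, of B L x] B L by (simp add: D_avg)
      have div0: "divergence p x = 0" if "M < norm x" for x
        by (rule divergence_outside_support[OF p M that])
      have D0: "D n x = 0" if "M + 1 < norm x" for x
      proof -
        have "divergence p (x + w) = 0" if "norm w \<le> e n" for w
          using that \<open>M + 1 < norm x\<close> elim(2) norm_diff_ineq[of x w] by (intro div0) linarith
        then have "norm (D n x) \<le> 0"
          unfolding D_avg by (intro norm_average_le[OF Qn meas]) simp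
        then show ?thesis by simp
      qed
      have div0': "divergence p x = 0" if "M + 1 < norm x" for x
        using that by (intro div0) simp
      have int: "integrable lebesgue (\<lambda>x. v n x * D n x)" "integrable lebesgue (\<lambda>x. u x * D n x)"
          "integrable lebesgue (\<lambda>x. u x * divergence p x)"
        by (rule L1_loc_pairing(1)[OF v(1) D_cont D_le D0], assumption,
            rule L1_loc_pairing(1)[OF u D_cont D_le D0], assumption,
            rule L1_loc_pairing(1)[OF u cont B(2) div0'], assumption)
      have 1: "\<bar>LINT x|lebesgue. (v n x - u x) * D n x\<bar> \<le> B * ?I n"
        by (rule L1_loc_pairing(2)[OF L1_loc_diff[OF u v(1)] D_cont D_le D0])
      have 2: "\<bar>LINT x|lebesgue. u x * (D n x - divergence p x)\<bar> \<le> (L * e n) * ?J"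
        by (rule L1_loc_pairing(2)[OF u _ D_close])
           (auto intro: continuous_on_diff D_cont cont simp: D0 div0')
      have "(LINT x|lebesgue. v n x * D n x) - (LINT x|lebesgue. u x * divergence p x)
          = (LINT x|lebesgue. (v n x - u x) * D n x)
            + (LINT x|lebesgue. u x * (D n x - divergence p x))"
        using int by (simp add: left_diff_distrib right_diff_distrib)
      then show ?case using 1 2 by simp
    qed
  qed
  then show ?thesis by (rule LIM_zero_cancel)
qed

theorem theorem5p1:
  fixes rho :: "'a::euclidean_space \<Rightarrow> real"
  assumes "admissible_kernel rho"
    and "(LINT z|lebesgue. rho z) = real DIM('a)"
    and "closure {z. z \<noteq> 0 \<and> rho z \<noteq> 0} = cball 0 1"
  shows "Gamma_lim L1_loc_topology (\<lambda>\<epsilon>. nonlocal_TV (rescaled_kernel rho \<epsilon>)) TV (at_right 0)"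
  unfolding Gamma_lim_def
proof (intro allI impI)
  fix e :: "nat \<Rightarrow> real" assume e: "filterlim e (at_right 0) sequentially"
  have "\<exists>Q. averaging_kernel \<epsilon> Q \<and> (\<forall>p\<in>Cc_infinity. \<forall>x.
      nonlocal_div (rescaled_kernel rho \<epsilon>) p x = average Q (divergence p) x)" if "0 < \<epsilon>" for \<epsilon>
    using rescaled_kernel_average[OF assms that] by metis
  then obtain Q where Q: "\<And>\<epsilon>. 0 < \<epsilon> \<Longrightarrow> averaging_kernel \<epsilon> (Q \<epsilon>)"
    and eq: "\<And>\<epsilon> p x. 0 < \<epsilon> \<Longrightarrow> p \<in> Cc_infinity \<Longrightarrow>
      nonlocal_div (rescaled_kernel rho \<epsilon>) p x = average (Q \<epsilon>) (divergence p) x"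
    by metis
  have epos: "\<forall>\<^sub>F n in sequentially. 0 < e n"
    using e by (auto simp: filterlim_at elim: eventually_mono)
  show "Gamma_lim_seq L1_loc_topology (\<lambda>n. nonlocal_TV (rescaled_kernel rho (e n))) TV"
    unfolding Gamma_lim_seq_def topspace_L1_loc_topology
  proof (intro conjI ballI allI impI)
    fix u :: "'a \<Rightarrow> real" and v
    assume v: "range v \<subseteq> L1_loc \<and> limitin L1_loc_topology v u sequentially"
    show "TV u \<le> liminf (\<lambda>n. nonlocal_TV (rescaled_kernel rho (e n)) (v n))"
      unfolding TV_def
    proof (rule SUP_least)
      fix p :: "'a \<Rightarrow> 'a" assume p: "p \<in> admissible_fields"
      then have Cc: "p \<in> Cc_infinity" by (simp add: admissible_fields_def)
      let ?a = "\<lambda>n. LINT x|lebesgue. v n x * nonlocal_div (rescaled_kernel rho (e n)) p x"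
      have "?a \<longlonglongrightarrow> (LINT x|lebesgue. u x * divergence p x)"
        by (rule pairing_nonlocal_div_tendsto[where Q = "\<lambda>n. Q (e n)", OF Q eq[OF _ Cc] e _ _ Cc])
           (use v in auto)
      then have "ereal (LINT x|lebesgue. u x * divergence p x) = liminf (\<lambda>n. ereal (?a n))"
        by (intro lim_imp_Liminf[symmetric] tendsto_ereal) auto
      also have "\<dots> \<le> liminf (\<lambda>n. nonlocal_TV (rescaled_kernel rho (e n)) (v n))"
        unfolding nonlocal_TV_def by (intro Liminf_mono always_eventually allI SUP_upper p)
      finally show "ereal (LINT x|lebesgue. u x * divergence p x)
          \<le> liminf (\<lambda>n. nonlocal_TV (rescaled_kernel rho (e n)) (v n))" .
    qed
  next
    fix u :: "'a \<Rightarrow> real" assume u: "u \<in> L1_loc"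
    \<comment> \<open>Since the nonlocal variation never exceeds the local one, the constant sequence recovers.\<close>
    show "\<exists>v. range v \<subseteq> L1_loc \<and> limitin L1_loc_topology v u sequentially \<and>
        limsup (\<lambda>n. nonlocal_TV (rescaled_kernel rho (e n)) (v n)) \<le> TV u"
    proof (intro exI[of _ "\<lambda>_. u"] conjI)
      show "limitin L1_loc_topology (\<lambda>_. u) u sequentially"
        using u by (simp add: limitin_const_iff)
      show "limsup (\<lambda>n. nonlocal_TV (rescaled_kernel rho (e n)) u) \<le> TV u"
        by (rule Limsup_bounded, rule eventually_mono[OF epos], rule nonlocal_TV_le_TV[OF Q eq])
    qed (use u in auto)
  qed
qed

end
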